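(* Let $\Gamma\subset\mathbb{R}^2$ be a compact connected set with $\dim_H(\Gamma)>1$. Then for every $s$ with $\frac{1}{2}+\sqrt{\dim_H(\Gamma)-\frac{3}{4}}<s\leq\dim_H(\Gamma)$, \[\dim_H\{x\in\mathbb{R}^2:\dim_H(\Gamma_x)>s\}\leq\frac{\dim_H(\Gamma)-s}{s-1}.\]
   Context: $\dim_H$ denotes Hausdorff dimension. For a compact set $\Gamma\subset\mathbb{R}^2$ and $x\in\mathbb{R}^2$, the visible part of $\Gamma$ from $x$ is \[\Gamma_x=\{u\in\Gamma: [x,u]\cap\Gamma=\{u\}\},\] where $[x,u]$ denotes the closed line segment joining $x$ to $u$. *)

theory Defs
  imports "HOL-Analysis.Analysis"
begin

text \<open>The summand \<open>(diam U)\<^sup>s\<close> of the Hausdorff measure, with \<open>0\<^sup>0 = 1\<close> for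
  nonempty \<open>U\<close> (whereas \<open>0 powr 0 = 0\<close>) and the empty set contributing \<open>0\<close>.\<close>

definition diam_power :: "real \<Rightarrow> 'a::metric_space set \<Rightarrow> ennreal" where
  "diam_power s U =
     (if U = {} then 0 else if s = 0 then 1 else ennreal (diameter U powr s))"

text \<open>Boundedness is required because \<^const>\<open>diameter\<close> is unspecified on unbounded sets.
  Finite covers are included by padding with \<open>{}\<close>.\<close>

definition hausdorff_content :: "real \<Rightarrow> real \<Rightarrow> 'a::metric_space set \<Rightarrow> ennreal" where
  "hausdorff_content s \<delta> A =
     (INF U \<in> {U :: nat \<Rightarrow> 'a set.
                 A \<subseteq> (\<Union>i. U i) \<and> (\<forall>i. bounded (U i) \<and> diameter (U i) \<le> \<delta>)}.
        \<Sum>i. diam_power s (U i))"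

definition hausdorff_measure :: "real \<Rightarrow> 'a::metric_space set \<Rightarrow> ennreal" where
  "hausdorff_measure s A = (SUP \<delta>\<in>{0<..}. hausdorff_content s \<delta> A)"

text \<open>Here \<open>dim {} = 0\<close>; the value is \<open>\<infinity>\<close> only if no \<open>s\<close>-dimensional measure vanishes,
  which does not happen in a Euclidean space.\<close>

definition hausdorff_dim :: "'a::metric_space set \<Rightarrow> ereal" where
  "hausdorff_dim A = (INF s \<in> {s. 0 \<le> s \<and> hausdorff_measure s A = 0}. ereal s)"

definition visible_part :: "'a::real_vector set \<Rightarrow> 'a \<Rightarrow> 'a set" where
  "visible_part \<Gamma> x = {u \<in> \<Gamma>. closed_segment x u \<inter> \<Gamma> = {u}}"

end

theory Submission
  imports Defs
begin

text \<open>
  Write \<open>d\<close> for the dimension of \<open>\<Gamma>\<close>, and fix \<open>t < 1\<close> slightly above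
  \<open>(d - s) / (s - 1)\<close>. The set of viewpoints that see a part of dimension greater than
  \<open>s\<close> is shown to have \<open>t\<close>-dimensional measure zero by a second moment argument over pairs
  of viewpoints, one scale \<open>r = 1 / 2 ^ k\<close> at a time.

  \<^item> \<open>\<Gamma>\<close> has covers by arbitrarily small dyadic squares, with at most about
    \<open>r powr (-d)\<close> squares of each side \<open>r\<close> (\<open>dyadic_cover\<close>). A visible part
    of positive \<open>s\<close>-dimensional content must meet about \<open>r powr (-s)\<close> of the squares of
    side \<open>r\<close> for some \<open>r\<close>, since otherwise those squares would cover it too cheaply. Hence
    each viewpoint is rich at some scale, and it is enough to bound the content of the set \<open>Y\<close> of
    viewpoints that are rich at scale \<open>r\<close> by a summable sequence.

  \<^item> By the discrete form of Frostman's lemma (\<open>discrete_frostman\<close>), \<open>Y\<close> carries a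
    finitely supported mass that gives at most \<open>\<rho> powr t\<close> to each square of side
    \<open>\<rho>\<close> and whose total \<open>W\<close> bounds the content of \<open>Y\<close> up to a constant.
    Counting incidences between viewpoints and squares, the Cauchy--Schwarz inequality gives
    \<open>W * r powr (-2 * s) \<le> r powr (-d) * B\<close>, where \<open>B\<close> bounds, for every
    \<open>x\<close>, the integral over \<open>y\<close> of the number of squares seen from both \<open>x\<close> and
    \<open>y\<close> (\<open>weighted_overlap\<close>).

  \<^item> That number is at most about \<open>1 / (r \<rho>)\<close>, up to a logarithm, when \<open>x\<close> and
    \<open>y\<close> have distance \<open>\<rho>\<close> (\<open>card_squares_seen_from_both\<close>), and one may
    select \<open>r powr (-s)\<close> squares for each viewpoint, so it is also at most
    \<open>r powr (-s)\<close>. The two bounds agree at \<open>\<rho> = r powr (s - 1)\<close>. As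
    \<open>t < 1\<close>, the distances near this one dominate the integral, so \<open>B\<close> is about
    \<open>r powr (-s) * \<rho> powr t\<close> for this \<open>\<rho>\<close>. Therefore \<open>W\<close> is at
    most about \<open>r\<close> to the power \<open>t (s - 1) - (d - s)\<close>, which is positive; this is
    summable over dyadic scales (\<open>content_of_rich_viewpoints\<close>, \<open>content_rich_piece_null\<close>).

  The hypothesis on \<open>s\<close> says that \<open>d - s < (s - 1)\<^sup>2\<close>, which puts the threshold
  \<open>(d - s) / (s - 1)\<close> below \<open>s - 1 \<le> 1\<close> and so leaves room for
  \<open>t\<close>.

  Connectedness enters only through the bound for pairs. If the lines of sight \<open>[x, u]\<close> and
  \<open>[y, v]\<close> cross, then together with \<open>[x, y]\<close> they bound a triangle whose boundary misses
  \<open>\<Gamma>\<close>, so the triangle contains no point of \<open>\<Gamma>\<close>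
  (\<open>no_point_in_visible_triangle\<close>). In the coordinates given by the slopes seen from \<open>x\<close> and
  from \<open>y\<close>, this forbids a permutation pattern of length three in the 0-1 matrix of occupied cells, and
  such a matrix has linearly many entries (\<open>pattern_avoiding_card\<close>). For squares at distance about
  \<open>H\<close> from the line through \<open>x\<close> and \<open>y\<close>, the matrix has about
  \<open>H / r\<close> rows and columns, and the two directions make an angle of about \<open>\<rho> H\<close>, so
  a matrix cell is a thin parallelogram that contains about \<open>1 / (\<rho> H)\<close> squares. The product does
  not depend on \<open>H\<close>, and the dyadic values of \<open>H\<close> contribute the logarithm.
\<close>

section \<open>The dyadic grid\<close>

text \<open>The half-open dyadic square of side \<open>1 / 2 ^ k\<close> that contains \<open>z\<close>, named by its integer
  corner. A square is thus a fibre of a function, and the squares of one side partition the plane.\<close>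

definition cell :: "nat \<Rightarrow> real^2 \<Rightarrow> int \<times> int" where
  "cell k z = (\<lfloor>2 ^ k * z $ 1\<rfloor>, \<lfloor>2 ^ k * z $ 2\<rfloor>)"

lemma norm_le_abs_sum2: "norm (z :: real^2) \<le> \<bar>z $ 1\<bar> + \<bar>z $ 2\<bar>"
  using norm_le_l1_cart[of z] by (simp add: sum_2)

lemma dist_same_cell:
  assumes "cell k u = cell k v"
  shows "dist u v \<le> 2 / 2 ^ k"
proof -
  have *: "\<bar>u $ i - v $ i\<bar> \<le> 1 / 2 ^ k" if "\<lfloor>2 ^ k * u $ i\<rfloor> = \<lfloor>2 ^ k * v $ i\<rfloor>" for i
  proof -
    have "\<bar>2 ^ k * u $ i - 2 ^ k * v $ i\<bar> \<le> 1"
      using that by linarith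
    then have "2 ^ k * \<bar>u $ i - v $ i\<bar> \<le> 1"
      by (simp add: abs_mult flip: right_diff_distrib)
    then show ?thesis by (simp add: field_simps)
  qed
  have "dist u v \<le> \<bar>u $ 1 - v $ 1\<bar> + \<bar>u $ 2 - v $ 2\<bar>"
    using norm_le_abs_sum2[of "u - v"] by (simp add: dist_norm)
  also have "\<dots> \<le> 1 / 2 ^ k + 1 / 2 ^ k"
    using assms by (intro add_mono *) (auto simp: cell_def)
  finally show ?thesis by simp
qed

lemma cells_near:
  assumes "dist u v \<le> real m / 2 ^ k"
  shows "cell k v \<in> {fst (cell k u) - int m .. fst (cell k u) + int m} \<times>
                    {snd (cell k u) - int m .. snd (cell k u) + int m}"
proof -
  have *: "\<lfloor>2 ^ k * v $ i\<rfloor> \<in> {\<lfloor>2 ^ k * u $ i\<rfloor> - int m .. \<lfloor>2 ^ k * u $ i\<rfloor> + int m}" for i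
  proof -
    have "\<bar>u $ i - v $ i\<bar> \<le> real m / 2 ^ k"
      using assms dist_vec_nth_le[of u i v] by (simp add: dist_real_def)
    then have "2 ^ k * \<bar>u $ i - v $ i\<bar> \<le> real m" by (simp add: field_simps)
    then have "\<bar>2 ^ k * u $ i - 2 ^ k * v $ i\<bar> \<le> real m"
      by (simp add: abs_mult flip: right_diff_distrib)
    then show ?thesis unfolding atLeastAtMost_iff by linarith
  qed
  show ?thesis using *[of 1] *[of 2] by (auto simp: cell_def)
qed

lemma card_near_cells:
  assumes "\<And>v. v \<in> A \<Longrightarrow> dist u v \<le> real m / 2 ^ k"
  shows "finite (cell k ` A)" "card (cell k ` A) \<le> (2 * m + 1)\<^sup>2"
proof -
  let ?B = "{fst (cell k u) - int m .. fst (cell k u) + int m} \<times>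
                    {snd (cell k u) - int m .. snd (cell k u) + int m}"
  have sub: "cell k ` A \<subseteq> ?B" using cells_near assms by blast
  show "finite (cell k ` A)" using sub by (rule finite_subset) simp
  have "card (cell k ` A) \<le> card ?B" using sub by (intro card_mono) auto
  also have "\<dots> = (2 * m + 1)\<^sup>2" by (simp add: card_cartesian_product power2_eq_square nat_add_distrib nat_mult_distrib)
  finally show "card (cell k ` A) \<le> (2 * m + 1)\<^sup>2" .
qed

lemma cell_parent:
  assumes "cell (Suc k) u = cell (Suc k) v"
  shows "cell k u = cell k v"
proof -
  have *: "\<lfloor>2 ^ k * z\<rfloor> = \<lfloor>2 ^ Suc k * z\<rfloor> div 2" for z :: real
  proof -
    have "2 ^ k * z = (2 ^ Suc k * z) / 2" by simp
    then show ?thesis by (metis floor_divide_real_eq_div of_int_numeral zero_le_numeral)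
  qed
  show ?thesis using assms unfolding cell_def by (auto simp only: * prod.inject)
qed

lemma cell_ancestor:
  assumes "cell i u = cell i v" "j \<le> i"
  shows "cell j u = cell j v"
  using assms(2,1) by (induction rule: inc_induct) (auto dest: cell_parent)

lemma dyadic_bracket:
  fixes g :: real
  assumes "1 \<le> g" "g \<le> 2 ^ n"
  obtains j where "j \<le> n" "2 ^ j \<le> g" "g \<le> 2 ^ Suc j"
proof -
  have "\<exists>j\<le>n. 2 ^ j \<le> g \<and> g \<le> 2 ^ Suc j"
    using assms(2)
  proof (induction n)
    case 0 then show ?case using assms(1) by auto
  next
    case (Suc n)
    then show ?case
    proof (cases "g \<le> 2 ^ n")
      case True then show ?thesis using Suc.IH le_SucI by blast
    next
      case False then show ?thesis using Suc.prems by (intro exI[of _ n]) auto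
    qed
  qed
  then show thesis using that by blast
qed

section \<open>Hausdorff content\<close>

text \<open>Hausdorff content without a bound on the size of the covering sets. It has the null sets of
  the Hausdorff measure but is finite on bounded sets, so it can be compared with masses.\<close>

definition content_inf :: "real \<Rightarrow> 'a::metric_space set \<Rightarrow> ennreal" where
  "content_inf s A = (INF U \<in> {U :: nat \<Rightarrow> 'a set. A \<subseteq> (\<Union>i. U i) \<and> (\<forall>i. bounded (U i))}.
     \<Sum>i. ennreal (diameter (U i) powr s))"

lemma content_inf_lower:
  "A \<subseteq> (\<Union>i. U i) \<Longrightarrow> (\<And>i. bounded (U i)) \<Longrightarrow> content_inf s A \<le> (\<Sum>i::nat. ennreal (diameter (U i) powr s))"
  unfolding content_inf_def by (rule INF_lower) auto

lemma content_inf_less_cover: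
  assumes "content_inf s A < e"
  obtains U :: "nat \<Rightarrow> 'a::metric_space set" where "A \<subseteq> (\<Union>i. U i)" "\<And>i. bounded (U i)"
    "(\<Sum>i. ennreal (diameter (U i) powr s)) < e"
  using assms unfolding content_inf_def INF_less_iff by auto

lemma diam_power_pos: "s > 0 \<Longrightarrow> diam_power s U = ennreal (diameter U powr s)"
  by (simp add: diam_power_def)

lemma content_inf_mono: "A \<subseteq> B \<Longrightarrow> content_inf s A \<le> content_inf s B"
  unfolding content_inf_def by (rule INF_superset_mono) auto

lemma content_inf_bounded:
  assumes "bounded A" "s > 0"
  shows "content_inf s A \<le> ennreal (diameter A powr s)"
proof -
  have "content_inf s A \<le> (\<Sum>i::nat. ennreal (diameter (if i = 0 then A else {}) powr s))"
    by (rule content_inf_lower) (use assms in \<open>auto split: if_splits\<close>)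
  also have "\<dots> = (\<Sum>i\<in>{0::nat}. ennreal (diameter (if i = 0 then A else {}) powr s))"
    by (rule suminf_finite) auto
  finally show ?thesis by simp
qed

lemma term_le_suminf: "f i \<le> (\<Sum>i. f i :: ennreal)"
  using sum_le_suminf[of f "{i}"] by simp

lemma content_inf_UN:
  fixes A :: "nat \<Rightarrow> 'a::metric_space set"
  assumes "s > 0"
  shows "content_inf s (\<Union>n. A n) \<le> (\<Sum>n. content_inf s (A n))"
proof (rule ennreal_le_epsilon)
  fix e :: real
  assume fin: "(\<Sum>n. content_inf s (A n)) < top" and e: "0 < e"
  have cfin: "content_inf s (A n) < top" for n
  proof -
    have "content_inf s (A n) \<le> (\<Sum>n. content_inf s (A n))"
      by (rule term_le_suminf)
    then show ?thesis using fin by order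
  qed
  have "\<exists>U. A n \<subseteq> (\<Union>i. U i) \<and> (\<forall>i. bounded (U i)) \<and>
      (\<Sum>i. ennreal (diameter (U i) powr s)) \<le> content_inf s (A n) + ennreal (e * (1/2) ^ Suc n)" for n
  proof -
    have "content_inf s (A n) + 0 < content_inf s (A n) + ennreal (e * (1/2) ^ Suc n)"
      unfolding ennreal_add_left_cancel_less using cfin[of n] e by (simp add: ennreal_zero_less_mult_iff)
    then have "content_inf s (A n) < content_inf s (A n) + ennreal (e * (1/2) ^ Suc n)" by simp
    then show ?thesis by (metis content_inf_less_cover less_imp_le)
  qed
  then obtain U where U: "\<And>n. A n \<subseteq> (\<Union>i. U n i)" "\<And>n i. bounded (U n i :: 'a set)"
    "\<And>n. (\<Sum>i. ennreal (diameter (U n i) powr s)) \<le> content_inf s (A n) + ennreal (e * (1/2) ^ Suc n)"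
    by metis
  let ?V = "\<lambda>j. case prod_decode j of (n, i) \<Rightarrow> U n i"
  have "content_inf s (\<Union>n. A n) \<le> (\<Sum>j. ennreal (diameter (?V j) powr s))"
  proof (rule content_inf_lower)
    show "(\<Union>n. A n) \<subseteq> (\<Union>j. ?V j)"
    proof
      fix x assume "x \<in> (\<Union>n. A n)"
      then obtain n i where "x \<in> U n i" using U(1) by blast
      then have "x \<in> ?V (prod_encode (n, i))" by simp
      then show "x \<in> (\<Union>j. ?V j)" by (rule UN_I[OF UNIV_I])
    qed
  qed (auto split: prod.split intro: U(2))
  also have "\<dots> = (\<Sum>n. \<Sum>i. ennreal (diameter (U n i) powr s))"
  proof -
    have "(\<lambda>j. ennreal (diameter (?V j) powr s)) =
        (\<lambda>j. (\<lambda>(n, i). ennreal (diameter (U n i) powr s)) (prod_decode j))"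
      by (rule ext) (simp add: split_beta)
    moreover have "(\<Sum>j. (\<lambda>(n, i). ennreal (diameter (U n i) powr s)) (prod_decode j)) =
        (\<Sum>n. \<Sum>i. ennreal (diameter (U n i) powr s))"
      by (rule suminf_ennreal_2dimen) (simp only: prod.case)
    ultimately show ?thesis by (simp only:)
  qed
  also have "\<dots> \<le> (\<Sum>n. content_inf s (A n) + ennreal (e * (1/2) ^ Suc n))"
    by (intro suminf_le U) auto
  also have "\<dots> = (\<Sum>n. content_inf s (A n)) + (\<Sum>n. ennreal (e * (1/2) ^ Suc n))"
    by (intro suminf_add[symmetric]) auto
  also have "(\<Sum>n. ennreal (e * (1/2) ^ Suc n)) = ennreal (\<Sum>n. e * (1/2) ^ Suc n)"
    using e by (intro suminf_ennreal2 summable_mult sums_summable[OF power_half_series]) auto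
  also have "(\<Sum>n. e * (1/2) ^ Suc n) = e"
    using sums_unique[OF sums_mult[OF power_half_series, of e]] by simp
  finally show "content_inf s (\<Union>n. A n) \<le> (\<Sum>n. content_inf s (A n)) + ennreal e" .
qed

lemma content_inf_empty: "s > 0 \<Longrightarrow> content_inf s {} = 0"
  using content_inf_bounded[of "{}" s] by simp

lemma content_inf_null_UN:
  fixes A :: "'i::countable \<Rightarrow> 'a::metric_space set"
  assumes "s > 0" "\<And>i. i \<in> I \<Longrightarrow> content_inf s (A i) = 0"
  shows "content_inf s (\<Union>i\<in>I. A i) = 0"
proof -
  let ?B = "\<lambda>n. if from_nat n \<in> I then A (from_nat n) else {}"
  have "(\<Union>i\<in>I. A i) \<subseteq> (\<Union>n. ?B n)"
  proof
    fix x assume "x \<in> (\<Union>i\<in>I. A i)"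
    then obtain i where "i \<in> I" "x \<in> A i" by blast
    then have "x \<in> ?B (to_nat i)" by simp
    then show "x \<in> (\<Union>n. ?B n)" by (rule UN_I[OF UNIV_I])
  qed
  then have "content_inf s (\<Union>i\<in>I. A i) \<le> content_inf s (\<Union>n. ?B n)" by (rule content_inf_mono)
  also have "\<dots> \<le> (\<Sum>n. content_inf s (?B n))" by (rule content_inf_UN) fact
  also have "(\<lambda>n. content_inf s (?B n)) = (\<lambda>n. 0)"
    using assms by (auto simp: content_inf_empty fun_eq_iff)
  finally show ?thesis by simp
qed

lemma content_inf_finite_UN:
  fixes A :: "'i \<Rightarrow> 'a::metric_space set"
  assumes "s > 0" "finite I" 
  shows "content_inf s (\<Union>i\<in>I. A i) \<le> (\<Sum>i\<in>I. content_inf s (A i))"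
  using assms(2)
proof (induction I)
  case (insert i I)
  let ?B = "\<lambda>n::nat. if n = 0 then A i else if n = 1 then (\<Union>i\<in>I. A i) else {}"
  have "(\<Union>i\<in>insert i I. A i) \<subseteq> (\<Union>n. ?B n)"
  proof
    fix x assume "x \<in> (\<Union>i\<in>insert i I. A i)"
    then have "x \<in> ?B 0 \<or> x \<in> ?B 1" by auto
    then show "x \<in> (\<Union>n. ?B n)"
      by (rule disjE) (erule UN_I[OF UNIV_I])+
  qed
  then have "content_inf s (\<Union>i\<in>insert i I. A i) \<le> content_inf s (\<Union>n. ?B n)" by (rule content_inf_mono)
  also have "\<dots> \<le> (\<Sum>n. content_inf s (?B n))" by (rule content_inf_UN) fact
  also have "\<dots> = (\<Sum>n\<in>{0,1}. content_inf s (?B n))" 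
    by (rule suminf_finite) (auto simp: content_inf_empty assms)
  also have "\<dots> = content_inf s (A i) + content_inf s (\<Union>i\<in>I. A i)" by simp
  also have "\<dots> \<le> (\<Sum>i\<in>insert i I. content_inf s (A i))"
    using insert by (simp add: add_left_mono)
  finally show ?case .
qed (simp add: content_inf_empty assms)

lemma diameter_powr_less_imp:
  assumes "(\<Sum>i::nat. ennreal (diameter (U i) powr s)) < ennreal (\<delta> powr s)" "s > 0" "\<delta> > 0"
    "bounded (U i)"
  shows "diameter (U i) < \<delta>"
proof -
  have "ennreal (diameter (U i) powr s) \<le> (\<Sum>i. ennreal (diameter (U i) powr s))"
    by (rule term_le_suminf)
  then have "ennreal (diameter (U i) powr s) < ennreal (\<delta> powr s)" using assms(1) by order
  then have "diameter (U i) powr s < \<delta> powr s" by (simp add: ennreal_less_iff)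
  moreover have "\<delta> powr s \<le> diameter (U i) powr s" if "\<delta> \<le> diameter (U i)"
    using that assms(2,3) by (intro powr_mono2) auto
  ultimately show ?thesis by (meson linorder_not_less)
qed

text \<open>A cover of small total \<open>s\<close>-cost has no large member, so for null sets the size
  restriction in the Hausdorff measure is immaterial.\<close>

lemma hausdorff_measure_eq_0_iff:
  assumes "s > 0"
  shows "hausdorff_measure s A = 0 \<longleftrightarrow> content_inf s A = 0"
proof
  assume "hausdorff_measure s A = 0"
  moreover have "hausdorff_content s 1 A \<le> hausdorff_measure s A"
    unfolding hausdorff_measure_def by (rule SUP_upper) simp
  ultimately have "hausdorff_content s 1 A = 0" by simp
  moreover have "content_inf s A \<le> hausdorff_content s 1 A"
    unfolding hausdorff_content_def content_inf_def diam_power_pos[OF assms]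
    by (rule INF_superset_mono) auto
  ultimately show "content_inf s A = 0" by simp
next
  assume 0: "content_inf s A = 0"
  have "hausdorff_content s \<delta> A = 0" if \<delta>: "\<delta> > 0" for \<delta>
  proof -
    have "hausdorff_content s \<delta> A \<le> 0 + ennreal e" if e: "e > 0" for e
    proof -
      have "content_inf s A < ennreal (min e (\<delta> powr s))" using e \<delta> 0 by simp
      then obtain U where U: "A \<subseteq> (\<Union>i. U i)" "\<And>i. bounded (U i)"
        "(\<Sum>i. ennreal (diameter (U i) powr s)) < ennreal (min e (\<delta> powr s))"
        by (rule content_inf_less_cover) blast
      have "diameter (U i) < \<delta>" for i
      proof (rule diameter_powr_less_imp)
        have "ennreal (min e (\<delta> powr s)) \<le> ennreal (\<delta> powr s)" by (intro ennreal_leI) simp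
        then show "(\<Sum>i. ennreal (diameter (U i) powr s)) < ennreal (\<delta> powr s)" using U(3) by order
      qed (use \<delta> assms U in auto)
      then have "hausdorff_content s \<delta> A \<le> (\<Sum>i. ennreal (diameter (U i) powr s))"
        unfolding hausdorff_content_def diam_power_pos[OF assms]
        using U by (intro INF_lower) (auto intro: less_imp_le)
      also have "\<dots> \<le> ennreal e"
      proof -
        have "ennreal (min e (\<delta> powr s)) \<le> ennreal e" by (intro ennreal_leI) simp
        then show ?thesis using U(3) by order
      qed
      finally show ?thesis by simp
    qed
    then have "hausdorff_content s \<delta> A \<le> 0" by (rule ennreal_le_epsilon)
    then show ?thesis by simp
  qed
  then show "hausdorff_measure s A = 0"
    unfolding hausdorff_measure_def by (intro antisym SUP_least) auto
qed

lemma content_inf_null_mono: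
  assumes "content_inf s A = 0" "0 < s" "s \<le> t"
  shows "content_inf t A = 0"
proof -
  have "content_inf t A \<le> 0 + ennreal e" if e: "e > 0" for e
  proof -
    have "content_inf s A < ennreal (min e (1 powr s))" using e assms by simp
    then obtain U where U: "A \<subseteq> (\<Union>i. U i)" "\<And>i. bounded (U i)"
      "(\<Sum>i. ennreal (diameter (U i) powr s)) < ennreal (min e (1 powr s))"
      by (rule content_inf_less_cover) blast
    have lt: "diameter (U i) < 1" for i
    proof (rule diameter_powr_less_imp)
      have "ennreal (min e (1 powr s)) \<le> ennreal (1 powr s)" by (intro ennreal_leI) simp
      then show "(\<Sum>i. ennreal (diameter (U i) powr s)) < ennreal (1 powr s)" using U(3) by order
    qed (use assms U in auto)
    have "content_inf t A \<le> (\<Sum>i. ennreal (diameter (U i) powr t))"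
      using U by (intro content_inf_lower) auto
    also have "\<dots> \<le> (\<Sum>i. ennreal (diameter (U i) powr s))"
      using lt U(2) assms by (intro suminf_le ennreal_leI powr_mono' diameter_ge_0) (auto intro: less_imp_le)
    also have "\<dots> \<le> ennreal e"
    proof -
      have "ennreal (min e (1 powr s)) \<le> ennreal e" by (intro ennreal_leI) simp
      then show ?thesis using U(3) by order
    qed
    finally show ?thesis by simp
  qed
  then have "content_inf t A \<le> 0" by (rule ennreal_le_epsilon)
  then show ?thesis by simp
qed

lemma hausdorff_dim_leI:
  assumes "s > 0" "content_inf s A = 0"
  shows "hausdorff_dim A \<le> ereal s"
  unfolding hausdorff_dim_def
  using assms by (intro INF_lower) (auto simp: hausdorff_measure_eq_0_iff)

lemma content_inf_eq_0_of_dim_less: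
  assumes "hausdorff_dim A < ereal s" "0 < hausdorff_dim A"
  shows "content_inf s A = 0"
proof -
  from assms(1) obtain s' where s': "0 \<le> s'" "hausdorff_measure s' A = 0" "s' < s"
    unfolding hausdorff_dim_def INF_less_iff by auto
  have "hausdorff_dim A \<le> ereal s'" unfolding hausdorff_dim_def using s' by (intro INF_lower) auto
  then have "s' > 0" using assms(2) by (metis ereal_less(2) less_le_trans)
  then show ?thesis using s' content_inf_null_mono[of s' A s] by (simp add: hausdorff_measure_eq_0_iff)
qed

section \<open>Matrices avoiding a permutation pattern\<close>

text \<open>The points are the entries of a 0-1 matrix. If a point has a neighbour below it in its column
  and one to its right in its row, then these two neighbours play the roles of \<open>u\<close> and \<open>v\<close>, so
  that no point can lie strictly to the upper left of it. After removal of the lowest point of each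
  column and the rightmost point of each row, no two of the remaining points are thus in strictly
  decreasing position, and every one of them is topmost in its column or rightmost in its row.\<close>

lemma pattern_avoiding_card:
  fixes P :: "('a::linorder \<times> 'b::linorder) set"
  assumes fin: "finite P"
    and avoid: "\<And>p u v. p \<in> P \<Longrightarrow> u \<in> P \<Longrightarrow> v \<in> P \<Longrightarrow>
       fst p < fst u \<Longrightarrow> fst u < fst v \<Longrightarrow> snd u < snd v \<Longrightarrow> snd v < snd p \<Longrightarrow> False"
  shows "card P \<le> 2 * card (fst ` P) + 2 * card (snd ` P)"
proof -
  define low where "low = {p \<in> P. \<forall>z\<in>P. fst z = fst p \<longrightarrow> snd p \<le> snd z}"
  define right where "right = {p \<in> P. \<forall>z\<in>P. snd z = snd p \<longrightarrow> fst z \<le> fst p}"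
  define P' where "P' = P - low - right"
  define top where "top = {p \<in> P'. \<forall>z\<in>P'. fst z = fst p \<longrightarrow> snd z \<le> snd p}"
  define right' where "right' = {p \<in> P'. \<forall>z\<in>P'. snd z = snd p \<longrightarrow> fst z \<le> fst p}"
  \<comment> \<open>The lower neighbour \<open>t\<close> and the right neighbour \<open>r\<close> complete the pattern.\<close>
  have free: "False" if p: "p \<in> P'" and z: "z \<in> P" "fst z < fst p" "snd z > snd p" for p z
  proof -
    from p obtain t where t: "t \<in> P" "fst t = fst p" "snd t < snd p"
      unfolding P'_def low_def by force
    from p obtain r where r: "r \<in> P" "snd r = snd p" "fst p < fst r"
      unfolding P'_def right_def by force
    show False using avoid[OF z(1) t(1) r(1)] z t r by simp
  qed
  have P': "P' \<subseteq> top \<union> right'"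
  proof
    fix p assume p: "p \<in> P'"
    show "p \<in> top \<union> right'"
    proof (rule ccontr)
      assume "p \<notin> top \<union> right'"
      then obtain z w where z: "z \<in> P'" "fst z = fst p" "snd z > snd p"
        and w: "w \<in> P'" "snd w = snd p" "fst w > fst p"
        using p unfolding top_def right'_def by force
      show False using free[OF w(1), of z] z w unfolding P'_def by auto
    qed
  qed
  have fin': "finite P'" "P' \<subseteq> P" using fin unfolding P'_def by auto
  have sub: "low \<subseteq> P" "right \<subseteq> P" "top \<subseteq> P" "right' \<subseteq> P"
    unfolding low_def right_def top_def right'_def P'_def by auto
  have "P \<subseteq> low \<union> right \<union> top \<union> right'" using P' unfolding P'_def by blast
  then have "card P \<le> card (low \<union> right \<union> top \<union> right')"
    using sub by (intro card_mono finite_subset[OF _ fin]) auto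
  also have "\<dots> \<le> card low + card right + card top + card right'"
    by (meson add_mono_thms_linordered_semiring(3) card_Un_le le_trans)
  also have "card low \<le> card (fst ` P)"
    by (rule card_inj_on_le[of fst]) (use fin in \<open>auto simp: inj_on_def low_def intro!: prod_eqI antisym\<close>)
  also have "card right \<le> card (snd ` P)"
    by (rule card_inj_on_le[of snd]) (use fin in \<open>auto simp: inj_on_def right_def intro!: prod_eqI antisym\<close>)
  also have "card top \<le> card (fst ` P)"
    by (rule card_inj_on_le[of fst]) (use fin fin' in \<open>auto simp: inj_on_def top_def intro!: prod_eqI antisym\<close>)
  also have "card right' \<le> card (snd ` P)"
    by (rule card_inj_on_le[of snd]) (use fin fin' in \<open>auto simp: inj_on_def right'_def intro!: prod_eqI antisym\<close>)
  finally show ?thesis by simp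
qed

section \<open>Signed areas and crossing lines of sight\<close>

definition det2 :: "real^2 \<Rightarrow> real^2 \<Rightarrow> real" where
  "det2 a b = a $ 1 * b $ 2 - a $ 2 * b $ 1"

text \<open>Twice the signed area of the triangle \<open>x y z\<close>: it is positive iff \<open>z\<close> lies to the left of the
  line directed from \<open>x\<close> to \<open>y\<close>.\<close>

definition orient :: "real^2 \<Rightarrow> real^2 \<Rightarrow> real^2 \<Rightarrow> real" where
  "orient x y z = det2 (y - x) (z - x)"

lemma inner_real2: "(a :: real^2) \<bullet> b = a $ 1 * b $ 1 + a $ 2 * b $ 2"
  by (simp add: inner_vec_def sum_2)

lemma det2_inner_squares: "(det2 a b)\<^sup>2 + (a \<bullet> b)\<^sup>2 = (norm a)\<^sup>2 * (norm b)\<^sup>2"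
proof -
  have "(norm v)\<^sup>2 = v $ 1 * v $ 1 + v $ 2 * v $ 2" for v :: "real^2"
    by (simp add: power2_norm_eq_inner inner_real2)
  note nn = this[of a] this[of b]
  show ?thesis unfolding inner_real2 det2_def nn by algebra
qed

lemma abs_det2_le: "\<bar>det2 a b\<bar> \<le> norm a * norm b"
proof -
  have "(det2 a b)\<^sup>2 \<le> (norm a * norm b)\<^sup>2"
    using det2_inner_squares[of a b] by (simp add: power_mult_distrib) (metis le_add_same_cancel1 zero_le_power2)
  then show ?thesis by (metis abs_le_square_iff abs_mult abs_norm_cancel)
qed

lemma det2_diff_right: "det2 a (b - c) = det2 a b - det2 a c" by (simp add: det2_def algebra_simps)

lemma orient_swap: "orient y x z = - orient x y z"
  by (simp add: orient_def det2_def algebra_simps)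

lemma orient_cycle: "orient y z x = orient x y z"
  by (simp add: orient_def det2_def algebra_simps)

lemma orient_affine:
  "orient x y (p + t *\<^sub>R (q - p)) = (1 - t) * orient x y p + t * orient x y q"
  by (simp add: orient_def det2_def algebra_simps)

lemma orient_same [simp]: "orient x y x = 0" "orient x y y = 0"
  by (simp_all add: orient_def det2_def)

lemma orient_eq_0_imp_on_line:
  assumes "orient x y z = 0" "x \<noteq> y"
  obtains t where "z = x + t *\<^sub>R (y - x)"
proof -
  let ?a = "y - x" and ?b = "z - x"
  have n: "(norm ?a)\<^sup>2 \<noteq> 0" using assms by simp
  have det: "?a $ 1 * ?b $ 2 = ?a $ 2 * ?b $ 1" using assms by (simp add: orient_def det2_def)
  have nn: "(norm ?a)\<^sup>2 = ?a $ 1 * ?a $ 1 + ?a $ 2 * ?a $ 2"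
    by (simp add: power2_norm_eq_inner inner_real2)
  have "(norm ?a)\<^sup>2 *\<^sub>R ?b = (?a \<bullet> ?b) *\<^sub>R ?a"
    unfolding vec_eq_iff forall_2 vector_scaleR_component real_scaleR_def nn inner_real2
    using det by algebra
  then have "inverse ((norm ?a)\<^sup>2) *\<^sub>R ((norm ?a)\<^sup>2 *\<^sub>R ?b) = inverse ((norm ?a)\<^sup>2) *\<^sub>R ((?a \<bullet> ?b) *\<^sub>R ?a)"
    by (rule arg_cong)
  then have "?b = (inverse ((norm ?a)\<^sup>2) * (?a \<bullet> ?b)) *\<^sub>R ?a" using n by simp
  then have "z = x + (inverse ((norm ?a)\<^sup>2) * (?a \<bullet> ?b)) *\<^sub>R ?a" by (metis add.commute diff_add_cancel)
  then show thesis by (rule that)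
qed

lemma continuous_orient [continuous_intros]: "continuous_on S (\<lambda>z. orient x y z)"
  unfolding orient_def det2_def by (intro continuous_intros)

lemma affine_in_segment:
  assumes "0 \<le> t" "t \<le> 1"
  shows "x + t *\<^sub>R (y - x) \<in> closed_segment x (y :: 'a :: real_vector)"
  unfolding in_segment using assms by (intro exI[of _ t]) (simp add: algebra_simps)

text \<open>The sign conditions say that the lines of sight from \<open>x\<close> to \<open>u\<close> and from \<open>y\<close> to \<open>v\<close> cross before
  they reach \<open>u\<close> and \<open>v\<close>, and that \<open>p\<close> is inside the triangle formed by the crossing point with \<open>x\<close>
  and \<open>y\<close>. The sides of this triangle are parts of \<open>[x, u]\<close>, \<open>[y, v]\<close> and \<open>[x, y]\<close> that miss \<open>\<Gamma>\<close>,
  while \<open>p\<close> is inside and \<open>u\<close> outside, which contradicts connectedness.\<close>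

lemma no_point_in_visible_triangle:
  fixes \<Gamma> :: "(real^2) set"
  assumes conn: "connected \<Gamma>"
    and u: "u \<in> visible_part \<Gamma> x" and v: "v \<in> visible_part \<Gamma> y" and p: "p \<in> \<Gamma>"
    and xy: "closed_segment x y \<inter> \<Gamma> = {}"
    and above: "orient x y u > 0" "orient x y v > 0"
    and cross: "orient y v u < 0" "orient x u v > 0"
    and inside: "orient x y p > 0" "orient x u p < 0" "orient y v p > 0"
  shows False
proof -
  have ne: "x \<noteq> y" "x \<noteq> u" "y \<noteq> v"
    using above by (auto simp: orient_def det2_def)
  have yx: "orient x u y < 0" "orient y v x > 0"
    using above orient_swap[of x u y] orient_cycle[of u x y] orient_cycle[of x y v] orient_cycle[of y v x]
    by (auto simp: orient_def det2_def algebra_simps)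
  \<comment> \<open>The interior of the triangle, and the complement of the closed triangle.\<close>
  let ?I = "{z. orient x y z > 0} \<inter> {z. orient x u z < 0} \<inter> {z. orient y v z > 0}"
  let ?O = "{z. orient x y z < 0} \<union> {z. orient x u z > 0} \<union> {z. orient y v z < 0}"
  have "open ?I" "open ?O"
    by (intro open_Int open_Un open_Collect_less continuous_intros)+
  moreover have "\<Gamma> \<subseteq> ?I \<union> ?O"
  proof
    fix z assume z: "z \<in> \<Gamma>"
    show "z \<in> ?I \<union> ?O"
    proof (rule ccontr)
      assume no: "z \<notin> ?I \<union> ?O"
      then have R: "orient x y z \<ge> 0" "orient x u z \<le> 0" "orient y v z \<ge> 0" by auto
      from no consider "orient x y z = 0" | "orient x u z = 0" | "orient y v z = 0" by force
      then show False
      proof cases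
        case 1
        then obtain t where t: "z = x + t *\<^sub>R (y - x)" using ne by (metis orient_eq_0_imp_on_line)
        have "t * orient x u y \<le> 0" using R(2) unfolding t orient_affine by simp
        then have t0: "t \<ge> 0" using yx by (simp add: mult_le_0_iff)
        have "(1 - t) * orient y v x \<ge> 0" using R(3) unfolding t orient_affine by simp
        then have t1: "t \<le> 1" using yx by (simp add: zero_le_mult_iff)
        show False using affine_in_segment[OF t0 t1, of x y] xy z t by auto
      next
        case 2
        then obtain t where t: "z = x + t *\<^sub>R (u - x)" using ne by (metis orient_eq_0_imp_on_line)
        have "t * orient x y u \<ge> 0" using R(1) unfolding t orient_affine by simp
        then have t0: "t \<ge> 0" using above by (simp add: zero_le_mult_iff)
        have "t < 1"
        proof (rule ccontr)
          assume "\<not> t < 1"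
          then have "(1 - t) * orient y v x \<le> 0" "t * orient y v u < 0"
            using yx cross by (auto simp: mult_le_0_iff mult_less_0_iff)
          then show False using R(3) unfolding t orient_affine by simp
        qed
        then have "z \<in> closed_segment x u" "z \<noteq> u"
          using affine_in_segment[OF t0, of x u] t ne
          by (auto simp: algebra_simps) (metis add_diff_cancel_left' add_diff_eq diff_add_cancel less_irrefl scaleR_cancel_right scaleR_one scaleR_right_diff_distrib right_minus_eq)
        then show False using u z unfolding visible_part_def by blast
      next
        case 3
        then obtain t where t: "z = y + t *\<^sub>R (v - y)" using ne by (metis orient_eq_0_imp_on_line)
        have "t * orient x y v \<ge> 0" using R(1) unfolding t orient_affine by simp
        then have t0: "t \<ge> 0" using above by (simp add: zero_le_mult_iff)
        have "t < 1"
        proof (rule ccontr)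
          assume "\<not> t < 1"
          then have "(1 - t) * orient x u y \<ge> 0" "t * orient x u v > 0"
            using yx cross by (auto simp: zero_le_mult_iff zero_less_mult_iff)
          then show False using R(2) unfolding t orient_affine by simp
        qed
        then have "z \<in> closed_segment y v" "z \<noteq> v"
          using affine_in_segment[OF t0, of y v] t ne
          by (auto simp: algebra_simps) (metis add_diff_cancel_left' add_diff_eq diff_add_cancel less_irrefl scaleR_cancel_right scaleR_one scaleR_right_diff_distrib right_minus_eq)
        then show False using v z unfolding visible_part_def by blast
      qed
    qed
  qed
  moreover have "?I \<inter> ?O \<inter> \<Gamma> = {}" by auto
  moreover have "p \<in> ?I \<inter> \<Gamma>" using inside p by auto
  moreover have "u \<in> ?O \<inter> \<Gamma>" using u cross by (auto simp: visible_part_def)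
  ultimately show False using connectedD[OF conn, of ?I ?O] by blast
qed

section \<open>Counting dyadic squares\<close>

lemma card_le_image_times_fibre:
  fixes b :: real
  assumes "finite S" "\<And>q. q \<in> S \<Longrightarrow> real (card {q' \<in> S. f q' = f q}) \<le> b"
  shows "real (card S) \<le> real (card (f ` S)) * b"
proof -
  have "real (card S) = (\<Sum>q\<in>S. 1)" by simp
  also have "\<dots> = (\<Sum>c\<in>f ` S. \<Sum>q\<in>{q \<in> S. f q = c}. 1)"
    by (rule sum.image_gen) fact
  also have "\<dots> \<le> (\<Sum>c\<in>f ` S. b)"
    using assms(2) by (intro sum_mono) auto
  finally show ?thesis by simp
qed

lemma card_floor_image:
  fixes f :: "'a \<Rightarrow> real"
  assumes "\<And>q. q \<in> S \<Longrightarrow> \<bar>f q - a\<bar> \<le> L" "0 \<le> L"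
  shows "finite ((\<lambda>q. \<lfloor>f q\<rfloor>) ` S)" "real (card ((\<lambda>q. \<lfloor>f q\<rfloor>) ` S)) \<le> 2 * L + 2"
proof -
  have sub: "(\<lambda>q. \<lfloor>f q\<rfloor>) ` S \<subseteq> {\<lfloor>a - L\<rfloor>..\<lfloor>a + L\<rfloor>}"
  proof safe
    fix q assume "q \<in> S"
    from assms(1)[OF this] have "a - L \<le> f q" "f q \<le> a + L" by linarith+
    then show "\<lfloor>f q\<rfloor> \<in> {\<lfloor>a - L\<rfloor>..\<lfloor>a + L\<rfloor>}" by (auto intro: floor_mono)
  qed
  show "finite ((\<lambda>q. \<lfloor>f q\<rfloor>) ` S)" by (rule finite_subset[OF sub]) simp
  have "card ((\<lambda>q. \<lfloor>f q\<rfloor>) ` S) \<le> card {\<lfloor>a - L\<rfloor>..\<lfloor>a + L\<rfloor>}"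
    using sub by (intro card_mono) auto
  also have "\<dots> = nat (\<lfloor>a + L\<rfloor> - \<lfloor>a - L\<rfloor> + 1)" by simp
  finally have "card ((\<lambda>q. \<lfloor>f q\<rfloor>) ` S) \<le> nat (\<lfloor>a + L\<rfloor> - \<lfloor>a - L\<rfloor> + 1)" .
  moreover have "\<lfloor>a + L\<rfloor> - \<lfloor>a - L\<rfloor> + 1 \<ge> 0" "real_of_int (\<lfloor>a + L\<rfloor> - \<lfloor>a - L\<rfloor> + 1) \<le> 2 * L + 2"
    using assms(2) by linarith+
  ultimately show "real (card ((\<lambda>q. \<lfloor>f q\<rfloor>) ` S)) \<le> 2 * L + 2" by linarith
qed

lemma norm_le_det2_inner:
  assumes "A \<noteq> 0" "\<bar>det2 A d\<bar> \<le> a * norm A" "\<bar>A \<bullet> d\<bar> \<le> b * norm A"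
  shows "norm d \<le> a + b"
proof -
  have ab: "0 \<le> a * norm A" "0 \<le> b * norm A" using assms by linarith+
  then have ab': "0 \<le> a" "0 \<le> b" using assms(1) by (simp_all add: zero_le_mult_iff)
  have "(norm A * norm d)\<^sup>2 = (det2 A d)\<^sup>2 + (A \<bullet> d)\<^sup>2"
    by (simp add: det2_inner_squares power_mult_distrib)
  also have "\<dots> \<le> (a * norm A)\<^sup>2 + (b * norm A)\<^sup>2"
    using assms by (intro add_mono) (metis abs_le_square_iff abs_of_nonneg ab)+
  also have "\<dots> \<le> (norm A * (a + b))\<^sup>2"
    using ab' by (simp add: power2_eq_square algebra_simps)
  finally have "norm A * norm d \<le> norm A * (a + b)"
    using ab' by (simp add: power2_le_iff_abs_le)
  then show ?thesis using assms(1) by simp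
qed

text \<open>A strip of width comparable with the side of the squares meets at most a constant times as many
  squares as fit along its length. The squares are sorted by the integer part of the position
  along the strip.\<close>

lemma card_cells_tube:
  assumes fin: "finite S" and cellq: "\<And>q. q \<in> S \<Longrightarrow> cell k (u q) = q"
    and A: "A \<noteq> 0" and w: "0 \<le> w" and l: "0 \<le> l"
    and thin: "\<And>q. q \<in> S \<Longrightarrow> \<bar>det2 A (u q - z)\<bar> \<le> w / 2 ^ k * norm A"
    and short: "\<And>q. q \<in> S \<Longrightarrow> norm (u q - z) \<le> l"
  shows "real (card S) \<le> (2 * l * 2 ^ k + 2) * real ((2 * nat \<lceil>2 * w + 1\<rceil> + 1)\<^sup>2)"
proof -
  let ?N = "nat \<lceil>2 * w + 1\<rceil>"
  define f where "f q = (A \<bullet> (u q - z)) * 2 ^ k / norm A" for q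
  have nA: "norm A > 0" using A by simp
  have "real (card S) \<le> real (card ((\<lambda>q. \<lfloor>f q\<rfloor>) ` S)) * real ((2 * ?N + 1)\<^sup>2)"
  proof (rule card_le_image_times_fibre)
    fix q assume q: "q \<in> S"
    let ?F = "{q' \<in> S. \<lfloor>f q'\<rfloor> = \<lfloor>f q\<rfloor>}"
    have near: "dist (u q) (u q') \<le> real ?N / 2 ^ k" if q': "q' \<in> ?F" for q'
    proof -
      let ?d = "u q - u q'"
      have "\<bar>f q - f q'\<bar> \<le> 1" using q' by (auto) linarith
      moreover have "f q - f q' = (A \<bullet> ?d) * (2 ^ k / norm A)"
        using nA by (simp add: f_def field_simps inner_diff_right)
      ultimately have "\<bar>A \<bullet> ?d\<bar> * (2 ^ k / norm A) \<le> 1" by (simp add: abs_mult)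
      then have 1: "\<bar>A \<bullet> ?d\<bar> \<le> 1 / 2 ^ k * norm A" using nA by (simp add: field_simps)
      have "det2 A ?d = det2 A (u q - z) - det2 A (u q' - z)"
        by (simp flip: det2_diff_right)
      then have "\<bar>det2 A ?d\<bar> \<le> w / 2 ^ k * norm A + w / 2 ^ k * norm A"
        using thin[OF q] thin[of q'] q' by auto
      then have 2: "\<bar>det2 A ?d\<bar> \<le> 2 * w / 2 ^ k * norm A" by simp
      have "norm ?d \<le> 2 * w / 2 ^ k + 1 / 2 ^ k" by (rule norm_le_det2_inner[OF A 2 1])
      also have "\<dots> = (2 * w + 1) / 2 ^ k" by (simp add: add_divide_distrib)
      also have "\<dots> \<le> real ?N / 2 ^ k"
        using w by (intro divide_right_mono) (auto simp: real_nat_ceiling_ge)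
      finally show ?thesis by (simp add: dist_norm)
    qed
    have "card (cell k ` (u ` ?F)) \<le> (2 * ?N + 1)\<^sup>2"
      by (rule card_near_cells[where u = "u q"]) (use q near in auto)
    moreover have "cell k ` (u ` ?F) = ?F" using cellq by (force simp: image_image)
    ultimately show "real (card ?F) \<le> real ((2 * ?N + 1)\<^sup>2)" by (simp only: of_nat_le_iff)
  qed fact
  also have "real (card ((\<lambda>q. \<lfloor>f q\<rfloor>) ` S)) \<le> 2 * (l * 2 ^ k) + 2"
  proof (rule card_floor_image(2)[where a = 0])
    fix q assume q: "q \<in> S"
    have "\<bar>A \<bullet> (u q - z)\<bar> \<le> norm A * l"
      using Cauchy_Schwarz_ineq2[of A "u q - z"] short[OF q] mult_left_mono[OF short[OF q], of "norm A"]
      by simp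
    then show "\<bar>f q - 0\<bar> \<le> l * 2 ^ k"
      using nA by (simp add: f_def abs_mult field_simps)
  qed (use l in simp)
  finally show ?thesis by (simp add: mult_ac mult_right_mono)
qed

section \<open>Squares seen from two points\<close>

text \<open>The tangent of the angle between the direction \<open>e\<close> and the ray from \<open>x\<close> through \<open>z\<close>.\<close>

definition slope :: "real^2 \<Rightarrow> real^2 \<Rightarrow> real^2 \<Rightarrow> real" where
  "slope e x z = det2 e (z - x) / (e \<bullet> (z - x))"

text \<open>Viewpoints \<open>X\<close> and targets \<open>Z\<close>, with all targets ahead of all viewpoints in the direction \<open>e\<close>
  at distances between \<open>\<kappa>\<close> and \<open>M\<close>. Slopes are then bounded coordinates that are comparable with
  signed areas, and all constants below depend on \<open>\<kappa>\<close> and \<open>M\<close> alone.\<close>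

locale view =
  fixes e :: "real^2" and X Z :: "(real^2) set" and \<kappa> M :: real
  assumes unit: "norm e = 1" and \<kappa>: "0 < \<kappa>" and M_nonneg: "0 \<le> M"
    and ahead: "\<And>x z. x \<in> X \<Longrightarrow> z \<in> Z \<Longrightarrow> \<kappa> \<le> e \<bullet> (z - x)"
    and near: "\<And>x z. x \<in> X \<Longrightarrow> z \<in> Z \<Longrightarrow> norm (z - x) \<le> M"
begin

lemma orient_slope:
  assumes "x \<in> X" "z \<in> Z" "z' \<in> Z"
  shows "orient x z z' = (e \<bullet> (z - x)) * (e \<bullet> (z' - x)) * (slope e x z' - slope e x z)"
proof -
  have "e $ 1 * e $ 1 + e $ 2 * e $ 2 = 1"
    using unit by (simp add: norm_eq_sqrt_inner inner_real2)
  then have "det2 (z - x) (z' - x) = (e \<bullet> (z - x)) * det2 e (z' - x) - det2 e (z - x) * (e \<bullet> (z' - x))"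
    unfolding det2_def inner_real2 by algebra
  moreover have "e \<bullet> (z - x) \<noteq> 0" "e \<bullet> (z' - x) \<noteq> 0"
    using ahead[OF assms(1,2)] ahead[OF assms(1,3)] \<kappa> by auto
  moreover have "p * q * (b / q - a / p) = p * b - a * q" if "p \<noteq> 0" "q \<noteq> 0" for a b p q :: real
    using that by (simp add: field_simps)
  ultimately show ?thesis unfolding orient_def slope_def by simp
qed

lemma orient_sign:
  assumes "x \<in> X" "z \<in> Z" "z' \<in> Z"
  shows "orient x z z' > 0 \<longleftrightarrow> slope e x z < slope e x z'"
    and "orient x z z' < 0 \<longleftrightarrow> slope e x z' < slope e x z"
proof -
  have "(e \<bullet> (z - x)) * (e \<bullet> (z' - x)) > 0"
    using ahead[OF assms(1,2)] ahead[OF assms(1,3)] \<kappa> by (intro mult_pos_pos) auto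
  then show "orient x z z' > 0 \<longleftrightarrow> slope e x z < slope e x z'"
    "orient x z z' < 0 \<longleftrightarrow> slope e x z' < slope e x z"
    unfolding orient_slope[OF assms] by (auto simp: zero_less_mult_iff mult_less_0_iff)
qed

lemma slope_diff_le:
  assumes "x \<in> X" "z \<in> Z" "z' \<in> Z"
  shows "\<kappa>\<^sup>2 * \<bar>slope e x z' - slope e x z\<bar> \<le> \<bar>orient x z z'\<bar>"
    and "\<bar>orient x z z'\<bar> \<le> M\<^sup>2 * \<bar>slope e x z' - slope e x z\<bar>"
proof -
  let ?p = "e \<bullet> (z - x)" and ?q = "e \<bullet> (z' - x)"
  have p: "\<kappa> \<le> ?p" "\<kappa> \<le> ?q" using ahead assms by auto
  have "?p \<le> norm e * norm (z - x)" "?q \<le> norm e * norm (z' - x)" by (rule norm_cauchy_schwarz)+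
  then have q: "?p \<le> M" "?q \<le> M" using near[OF assms(1,2)] near[OF assms(1,3)] unit by auto
  have eq: "\<bar>orient x z z'\<bar> = ?p * ?q * \<bar>slope e x z' - slope e x z\<bar>"
    unfolding orient_slope[OF assms] using p \<kappa> by (simp add: abs_mult)
  show "\<kappa>\<^sup>2 * \<bar>slope e x z' - slope e x z\<bar> \<le> \<bar>orient x z z'\<bar>"
    unfolding eq power2_eq_square using p \<kappa> by (intro mult_right_mono mult_mono) auto
  show "\<bar>orient x z z'\<bar> \<le> M\<^sup>2 * \<bar>slope e x z' - slope e x z\<bar>"
    unfolding eq power2_eq_square using p q \<kappa> by (intro mult_right_mono mult_mono) auto
qed

lemma slope_diff_near:
  assumes "x \<in> X" "z \<in> Z" "z' \<in> Z"
  shows "\<kappa>\<^sup>2 * \<bar>slope e x z' - slope e x z\<bar> \<le> M * dist z z'"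
proof -
  have "\<bar>orient x z z'\<bar> = \<bar>det2 (z - x) (z' - z)\<bar>"
    by (simp add: orient_def det2_def algebra_simps)
  also have "\<dots> \<le> norm (z - x) * norm (z' - z)" by (rule abs_det2_le)
  also have "\<dots> \<le> M * dist z z'"
    using near[OF assms(1,2)] by (simp add: dist_norm norm_minus_commute mult_right_mono)
  finally show ?thesis using slope_diff_le(1)[OF assms] by linarith
qed

text \<open>The vector \<open>f\<close> directs a line through \<open>x\<close>, and \<open>h\<close> bounds the distances of \<open>z\<close> and \<open>z'\<close> from it.
  Targets close to this line are seen from \<open>x\<close> within a narrow angle.\<close>

lemma orient_le_of_heights:
  assumes "x \<in> X" "z \<in> Z" "z' \<in> Z" "f \<noteq> 0"
    "\<bar>det2 f (z - x)\<bar> \<le> norm f * h" "\<bar>det2 f (z' - x)\<bar> \<le> norm f * h"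
  shows "\<bar>orient x z z'\<bar> \<le> 2 * M * h"
proof -
  let ?A = "z - x" and ?B = "z' - x"
  have M: "norm ?A \<le> M" "norm ?B \<le> M" using near assms by auto
  have inn: "\<bar>f \<bullet> v\<bar> \<le> norm f * M" if "norm v \<le> M" for v
    using Cauchy_Schwarz_ineq2[of f v] mult_left_mono[OF that, of "norm f"] by simp
  have "(norm f)\<^sup>2 = f $ 1 * f $ 1 + f $ 2 * f $ 2"
    by (simp add: power2_norm_eq_inner inner_real2)
  then have "(norm f)\<^sup>2 * det2 ?A ?B = (f \<bullet> ?A) * det2 f ?B - det2 f ?A * (f \<bullet> ?B)"
    unfolding det2_def inner_real2 by algebra
  then have "\<bar>(norm f)\<^sup>2 * det2 ?A ?B\<bar> \<le> \<bar>f \<bullet> ?A\<bar> * \<bar>det2 f ?B\<bar> + \<bar>det2 f ?A\<bar> * \<bar>f \<bullet> ?B\<bar>"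
    using abs_triangle_ineq4[of "(f \<bullet> ?A) * det2 f ?B" "det2 f ?A * (f \<bullet> ?B)"]
    by (simp add: abs_mult)
  also have "\<dots> \<le> (norm f * M) * (norm f * h) + (norm f * h) * (norm f * M)"
    using assms(5,6) inn[OF M(1)] inn[OF M(2)] by (intro add_mono mult_mono) auto
  also have "\<dots> = (norm f)\<^sup>2 * (2 * M * h)" by (simp add: power2_eq_square)
  finally show ?thesis using assms(4) by (simp add: orient_def abs_mult)
qed

lemma slope_diff_of_same_square:
  assumes "x \<in> X" "z \<in> Z" "z' \<in> Z" "cell k z = cell k z'"
  shows "\<bar>slope e x z' - slope e x z\<bar> \<le> 2 * M / (\<kappa>\<^sup>2 * 2 ^ k)"
proof -
  have M: "0 \<le> M" using near[OF assms(1,2)] norm_ge_zero order_trans by blast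
  have "\<kappa>\<^sup>2 * \<bar>slope e x z' - slope e x z\<bar> \<le> M * dist z z'" by (rule slope_diff_near[OF assms(1-3)])
  also have "\<dots> \<le> M * (2 / 2 ^ k)" using dist_same_cell[OF assms(4)] M by (rule mult_left_mono)
  finally show ?thesis using \<kappa> by (simp add: field_simps)
qed

text \<open>The constant of the next lemma: \<open>2 * M ^ 3 / \<kappa> ^ 3\<close> is the half-width, in units of the side
  of a square, of a strip that contains the targets of nearly equal slope.\<close>

definition fibre_bound :: real where
  "fibre_bound = (8 * M ^ 4 / \<kappa>\<^sup>2 + 4 * M\<^sup>2) * real ((2 * nat \<lceil>2 * (2 * M ^ 3 / \<kappa> ^ 3) + 1\<rceil> + 1)\<^sup>2)"

text \<open>Targets whose slopes from \<open>x\<close> and from \<open>y\<close> agree up to about one side of a square lie in the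
  intersection of two strips. Since \<open>orient x y (u q)\<close> is the product of the lengths of the two lines
  of sight and the sine of the angle between them, the lower bound \<open>h\<close> makes this intersection a
  parallelogram with about \<open>1 / h\<close> squares along its length.\<close>

lemma card_slope_fibre:
  assumes fin: "finite S" and x: "x \<in> X" and y: "y \<in> X"
    and cellq: "\<And>q. q \<in> S \<Longrightarrow> cell k (u q) = q" and Z: "\<And>q. q \<in> S \<Longrightarrow> u q \<in> Z"
    and h: "0 < h" "\<And>q. q \<in> S \<Longrightarrow> h \<le> orient x y (u q)"
    and sx: "\<And>q q'. q \<in> S \<Longrightarrow> q' \<in> S \<Longrightarrow> \<bar>slope e x (u q') - slope e x (u q)\<bar> \<le> 2 * M / (\<kappa>\<^sup>2 * 2 ^ k)"
    and sy: "\<And>q q'. q \<in> S \<Longrightarrow> q' \<in> S \<Longrightarrow> \<bar>slope e y (u q') - slope e y (u q)\<bar> \<le> 2 * M / (\<kappa>\<^sup>2 * 2 ^ k)"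
  shows "real (card S) \<le> fibre_bound / h"
proof (cases "S = {}")
  case True
  then show ?thesis using h by (simp add: fibre_bound_def)
next
  case False
  then obtain p where p: "p \<in> S" by blast
  let ?A = "u p - x" and ?B = "u p - y"
  let ?m = "2 * M / (\<kappa>\<^sup>2 * 2 ^ k)"
  have M: "norm ?A \<le> M" "norm ?B \<le> M" using near x y Z[OF p] by auto
  then have M0: "0 \<le> M" using norm_ge_zero order_trans by blast
  have "?A \<bullet> e \<le> norm ?A * norm e" by (rule norm_cauchy_schwarz)
  then have kA: "\<kappa> \<le> norm ?A" using ahead[OF x Z[OF p]] unit by (simp add: inner_commute)
  have kM: "\<kappa> \<le> M" using kA M by linarith
  have det: "\<bar>det2 (u p - c) (u q - u p)\<bar> \<le> M\<^sup>2 * ?m"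
    if "q \<in> S" "c \<in> X" "\<bar>slope e c (u q) - slope e c (u p)\<bar> \<le> ?m" for q c
  proof -
    have "det2 (u p - c) (u q - u p) = orient c (u p) (u q)"
      by (simp add: orient_def det2_def algebra_simps)
    then show ?thesis
      using slope_diff_le(2)[OF that(2) Z[OF p] Z[OF that(1)]] mult_left_mono[OF that(3), of "M\<^sup>2"]
      by simp
  qed
  define l where "l = 4 * M ^ 4 / (\<kappa>\<^sup>2 * h * 2 ^ k)"
  have short: "norm (u q - u p) \<le> l" if q: "q \<in> S" for q
  proof -
    let ?d = "u q - u p"
    have D: "det2 ?A ?B = orient x y (u p)" by (simp add: orient_def det2_def algebra_simps)
    \<comment> \<open>Cramer's rule for \<open>?d\<close> in the basis of the two lines of sight.\<close>
    have "det2 ?A ?B *\<^sub>R ?d = det2 ?A ?d *\<^sub>R ?B - det2 ?B ?d *\<^sub>R ?A"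
      unfolding vec_eq_iff forall_2 vector_minus_component vector_scaleR_component real_scaleR_def det2_def
      by algebra
    then have "norm (det2 ?A ?B *\<^sub>R ?d) \<le> norm (det2 ?A ?d *\<^sub>R ?B) + norm (det2 ?B ?d *\<^sub>R ?A)"
      by (metis norm_triangle_ineq4)
    then have "\<bar>det2 ?A ?B\<bar> * norm ?d \<le> \<bar>det2 ?A ?d\<bar> * norm ?B + \<bar>det2 ?B ?d\<bar> * norm ?A"
      by simp
    also have "\<dots> \<le> M\<^sup>2 * ?m * M + M\<^sup>2 * ?m * M"
      using det[OF q x sx[OF p q]] det[OF q y sy[OF p q]] M by (intro add_mono mult_mono) auto
    finally have "h * norm ?d \<le> 2 * M * M\<^sup>2 * ?m"
      using h(2)[OF p] mult_right_mono[of h "\<bar>det2 ?A ?B\<bar>" "norm ?d"] D h(1) by (simp add: mult_ac)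
    then have "norm ?d \<le> (2 * M * M\<^sup>2 * ?m) / h"
      using h(1) by (simp only: pos_le_divide_eq mult.commute[of "norm ?d"])
    also have "\<dots> = l" using \<kappa> by (simp add: l_def field_simps power2_eq_square power4_eq_xxxx)
    finally show ?thesis .
  qed
  have thin: "\<bar>det2 ?A (u q - u p)\<bar> \<le> (2 * M ^ 3 / \<kappa> ^ 3) / 2 ^ k * norm ?A" if q: "q \<in> S" for q
  proof -
    have "\<bar>det2 ?A (u q - u p)\<bar> \<le> M\<^sup>2 * ?m" by (rule det[OF q x sx[OF p q]])
    also have "\<dots> = (2 * M ^ 3 / \<kappa> ^ 3) / 2 ^ k * \<kappa>"
      using \<kappa> by (simp add: field_simps power2_eq_square power3_eq_cube)
    also have "\<dots> \<le> (2 * M ^ 3 / \<kappa> ^ 3) / 2 ^ k * norm ?A"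
      using kA M0 \<kappa> by (intro mult_left_mono) auto
    finally show ?thesis .
  qed
  let ?N = "(2 * nat \<lceil>2 * (2 * M ^ 3 / \<kappa> ^ 3) + 1\<rceil> + 1)\<^sup>2"
  have "real (card S) \<le> (2 * l * 2 ^ k + 2) * real ?N"
    by (rule card_cells_tube[where z = "u p" and A = ?A and u = u])
      (use fin cellq M0 \<kappa> kA thin short h in \<open>auto simp: l_def\<close>)
  also have "\<dots> \<le> ((8 * M ^ 4 / \<kappa>\<^sup>2 + 4 * M\<^sup>2) / h) * real ?N"
  proof (rule mult_right_mono)
    have "\<bar>det2 (y - x) (u p - x)\<bar> \<le> norm (y - x) * norm (u p - x)" by (rule abs_det2_le)
    also have "\<dots> \<le> (2 * M) * M"
    proof (rule mult_mono)
      have "norm (y - x) \<le> norm ?A + norm ?B"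
        using norm_triangle_ineq4[of ?A ?B] by simp
      then show "norm (y - x) \<le> 2 * M" using M by linarith
    qed (use M M0 in auto)
    finally have "h \<le> 2 * M\<^sup>2" using h(2)[OF p] by (simp add: orient_def power2_eq_square)
    then have "2 \<le> 4 * M\<^sup>2 / h" using h(1) by (simp add: field_simps)
    moreover have "2 * l * 2 ^ k = 8 * M ^ 4 / \<kappa>\<^sup>2 / h" using \<kappa> h by (simp add: l_def field_simps)
    ultimately show "2 * l * 2 ^ k + 2 \<le> (8 * M ^ 4 / \<kappa>\<^sup>2 + 4 * M\<^sup>2) / h"
      by (simp add: add_divide_distrib)
  qed simp
  also have "\<dots> = fibre_bound / h" by (simp add: fibre_bound_def)
  finally show ?thesis .
qed

text \<open>The squares are indexed by the integer parts \<open>ind\<close> of their slopes from \<open>x\<close> and \<open>y\<close>, in units of the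
  slope \<open>m\<close> that one square may cover. The point \<open>u q\<close> that is visible from \<open>x\<close> and the point \<open>v q\<close>
  that is visible from \<open>y\<close> share a square but may differ, so strict inequalities between indices need
  not hold for their slopes. They do within a class of indices modulo 3, where different indices
  differ by at least 3. In each class the triangle lemma forbids the pattern of
  \<open>pattern_avoiding_card\<close>.\<close>

lemma card_squares_seen_at_height:
  fixes \<Gamma> :: "(real^2) set"
  assumes conn: "connected \<Gamma>" and x: "x \<in> X" and y: "y \<in> X"
    and xy: "closed_segment x y \<inter> \<Gamma> = {}" and fin: "finite S"
    and u: "\<And>q. q \<in> S \<Longrightarrow> u q \<in> visible_part \<Gamma> x \<inter> Z" "\<And>q. q \<in> S \<Longrightarrow> cell k (u q) = q"
    and v: "\<And>q. q \<in> S \<Longrightarrow> v q \<in> visible_part \<Gamma> y \<inter> Z" "\<And>q. q \<in> S \<Longrightarrow> cell k (v q) = q"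
    and \<rho>: "\<rho> = norm (y - x)" "0 < \<rho>" and H: "2 / 2 ^ k \<le> H"
    and hu: "\<And>q. q \<in> S \<Longrightarrow> \<rho> * H \<le> orient x y (u q)" "\<And>q. q \<in> S \<Longrightarrow> orient x y (u q) \<le> \<rho> * (5 * H)"
    and hv: "\<And>q. q \<in> S \<Longrightarrow> \<rho> * H \<le> orient x y (v q)"
  shows "real (card S) \<le> 396 * fibre_bound * 2 ^ k / \<rho>"
proof (cases "S = {}")
  case True
  then show ?thesis using \<rho>(2) by (simp add: fibre_bound_def)
next
  case False
  then obtain q0 where q0: "q0 \<in> S" by blast
  have uZ: "u q \<in> Z" and u\<Gamma>: "u q \<in> \<Gamma>" and vZ: "v q \<in> Z" if "q \<in> S" for q
    using u(1)[OF that] v(1)[OF that] by (auto simp: visible_part_def)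
  have uv: "cell k (u q) = cell k (v q)" if "q \<in> S" for q using that u(2) v(2) by simp
  have Hpos: "0 < H" using H by (rule less_le_trans[rotated]) simp
  have H2: "2 \<le> H * 2 ^ k" using H by (simp add: field_simps)
  have "e \<bullet> (u q0 - x) \<le> norm e * norm (u q0 - x)" by (rule norm_cauchy_schwarz)
  then have M: "0 < M" using ahead[OF x uZ[OF q0]] near[OF x uZ[OF q0]] unit \<kappa> by simp
  define m where "m = 2 * M / (\<kappa>\<^sup>2 * 2 ^ k)"
  have m: "0 < m" using M \<kappa> by (simp add: m_def)
  define \<alpha> where "\<alpha> = slope e x"
  define \<beta> where "\<beta> = slope e y"
  define ind where "ind q = (\<lfloor>\<alpha> (u q) / m\<rfloor>, \<lfloor>\<beta> (u q) / m\<rfloor>)" for q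
  have same: "\<bar>s - t\<bar> \<le> m" if "\<lfloor>s / m\<rfloor> = \<lfloor>t / m\<rfloor>" for s t
  proof -
    have "\<bar>s / m - t / m\<bar> \<le> 1" using that by linarith
    then show ?thesis using m by (simp add: field_simps flip: diff_divide_distrib)
  qed
  have less: "s + 2 * m < t" if "\<lfloor>s / m\<rfloor> + 3 \<le> \<lfloor>t / m\<rfloor>" for s t
  proof -
    have "s / m + 2 < t / m" using that by linarith
    then have "(s / m + 2) * m < t / m * m" using m by (rule mult_strict_right_mono)
    then show ?thesis using m by (simp add: algebra_simps)
  qed
  have fibre: "real (card {q' \<in> S. ind q' = ind q}) \<le> fibre_bound / (\<rho> * H)" if "q \<in> S" for q
  proof (rule card_slope_fibre[OF _ x y])
    fix q1 q2 assume q: "q1 \<in> {q' \<in> S. ind q' = ind q}" "q2 \<in> {q' \<in> S. ind q' = ind q}"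
    then have "ind q2 = ind q1" by simp
    then show "\<bar>slope e x (u q2) - slope e x (u q1)\<bar> \<le> 2 * M / (\<kappa>\<^sup>2 * 2 ^ k)"
      "\<bar>slope e y (u q2) - slope e y (u q1)\<bar> \<le> 2 * M / (\<kappa>\<^sup>2 * 2 ^ k)"
      unfolding ind_def using same by (simp_all add: \<alpha>_def \<beta>_def m_def)
  qed (use fin u uZ hu \<rho>(2) Hpos in auto)
  have range: "finite ((\<lambda>q. \<lfloor>slope e z (u q) / m\<rfloor>) ` S)"
    "real (card ((\<lambda>q. \<lfloor>slope e z (u q) / m\<rfloor>) ` S)) \<le> 11 * (H * 2 ^ k)"
    if z: "z = x \<or> z = y" for z
  proof -
    have zX: "z \<in> X" using z x y by auto
    have b: "\<bar>slope e z (u q) / m - slope e z (u q0) / m\<bar> \<le> 5 * (H * 2 ^ k)" if q: "q \<in> S" for q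
    proof -
      have eq: "det2 (y - x) (w - z) = orient x y w" for w
        using z by (auto simp: orient_def det2_def algebra_simps)
      have bd: "\<bar>orient x y (u q)\<bar> \<le> norm (y - x) * (5 * H)" if "q \<in> S" for q
        using hu[OF that] mult_pos_pos[OF \<rho>(2) Hpos] unfolding \<rho>(1) by linarith
      have "\<kappa>\<^sup>2 * \<bar>slope e z (u q) - slope e z (u q0)\<bar> \<le> \<bar>orient z (u q0) (u q)\<bar>"
        by (rule slope_diff_le(1)[OF zX uZ[OF q0] uZ[OF q]])
      also have "\<dots> \<le> 2 * M * (5 * H)"
        by (rule orient_le_of_heights[OF zX uZ[OF q0] uZ[OF q], of "y - x"])
          (use \<rho> bd[OF q] bd[OF q0] in \<open>auto simp: eq\<close>)
      also have "\<dots> = \<kappa>\<^sup>2 * (5 * (H * 2 ^ k) * m)" using \<kappa> by (simp add: m_def)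
      finally have "\<bar>slope e z (u q) - slope e z (u q0)\<bar> \<le> 5 * (H * 2 ^ k) * m" using \<kappa> by simp
      then have "\<bar>slope e z (u q) - slope e z (u q0)\<bar> / m \<le> 5 * (H * 2 ^ k)"
        using m by (simp add: pos_divide_le_eq)
      moreover have "\<bar>slope e z (u q) / m - slope e z (u q0) / m\<bar> = \<bar>slope e z (u q) - slope e z (u q0)\<bar> / m"
        using m by (simp flip: diff_divide_distrib)
      ultimately show ?thesis by simp
    qed
    show "finite ((\<lambda>q. \<lfloor>slope e z (u q) / m\<rfloor>) ` S)"
      using fin by simp
    have "real (card ((\<lambda>q. \<lfloor>slope e z (u q) / m\<rfloor>) ` S)) \<le> 2 * (5 * (H * 2 ^ k)) + 2"
      by (rule card_floor_image(2)[OF b]) (use H2 in auto)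
    then show "real (card ((\<lambda>q. \<lfloor>slope e z (u q) / m\<rfloor>) ` S)) \<le> 11 * (H * 2 ^ k)"
      using H2 by linarith
  qed
  define T where "T c = {q \<in> S. (fst (ind q) mod 3, snd (ind q) mod 3) = c}" for c
  \<comment> \<open>Each class has at most \<open>11 * (H * 2 ^ k)\<close> rows and as many columns, and there are nine classes.\<close>
  have classes: "real (card (ind ` T c)) \<le> 44 * (H * 2 ^ k)" for c
  proof -
    have gap: "i + 3 \<le> j" if "i < j" "i mod 3 = j mod 3" for i j :: int
      using that by presburger
    have "card (ind ` T c) \<le> 2 * card (fst ` ind ` T c) + 2 * card (snd ` ind ` T c)"
    proof (rule pattern_avoiding_card)
      show "finite (ind ` T c)" using fin by (simp add: T_def)
      fix P U V assume "P \<in> ind ` T c" "U \<in> ind ` T c" "V \<in> ind ` T c"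
      then obtain p i j where pij: "p \<in> T c" "P = ind p" "i \<in> T c" "U = ind i" "j \<in> T c" "V = ind j"
        by blast
      then have S: "p \<in> S" "i \<in> S" "j \<in> S" by (auto simp: T_def)
      assume "fst P < fst U" "fst U < fst V" "snd U < snd V" "snd V < snd P"
      then have "fst P + 3 \<le> fst U" "fst U + 3 \<le> fst V" "snd U + 3 \<le> snd V" "snd V + 3 \<le> snd P"
        using pij by (auto intro!: gap simp: T_def)
      then have l: "\<alpha> (u p) + 2 * m < \<alpha> (u i)" "\<alpha> (u i) + 2 * m < \<alpha> (u j)"
        "\<beta> (u i) + 2 * m < \<beta> (u j)" "\<beta> (u j) + 2 * m < \<beta> (u p)"
        using pij by (auto intro!: less simp: ind_def)
      have "\<bar>\<alpha> (v j) - \<alpha> (u j)\<bar> \<le> m" "\<bar>\<beta> (v j) - \<beta> (u j)\<bar> \<le> m"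
        unfolding \<alpha>_def \<beta>_def m_def
        using slope_diff_of_same_square[OF x uZ[OF S(3)] vZ[OF S(3)] uv[OF S(3)]]
          slope_diff_of_same_square[OF y uZ[OF S(3)] vZ[OF S(3)] uv[OF S(3)]] by auto
      with l have l': "\<alpha> (u p) < \<alpha> (u i)" "\<alpha> (u i) < \<alpha> (v j)" "\<beta> (u i) < \<beta> (v j)" "\<beta> (v j) < \<beta> (u p)"
        using m by linarith+
      have pos: "0 < \<rho> * H" using \<rho> Hpos by simp
      show False
      proof (rule no_point_in_visible_triangle[OF conn _ _ _ xy])
        show "u i \<in> visible_part \<Gamma> x" "v j \<in> visible_part \<Gamma> y" "u p \<in> \<Gamma>"
          using u v S u\<Gamma> by auto
        show "orient x y (u i) > 0" "orient x y (v j) > 0" "orient x y (u p) > 0"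
          using hu(1)[OF S(1)] hu(1)[OF S(2)] hv[OF S(3)] pos by linarith+
        show "orient y (v j) (u i) < 0" "orient y (v j) (u p) > 0"
          using l' orient_sign[OF y vZ[OF S(3)] uZ] S by (auto simp: \<beta>_def)
        show "orient x (u i) (v j) > 0" "orient x (u i) (u p) < 0"
          using l' orient_sign[OF x uZ[OF S(2)]] uZ vZ S by (auto simp: \<alpha>_def)
      qed
    qed
    moreover have "card (fst ` ind ` T c) \<le> card ((\<lambda>q. \<lfloor>slope e x (u q) / m\<rfloor>) ` S)"
      using range(1)[of x] by (intro card_mono) (auto simp: ind_def \<alpha>_def T_def)
    moreover have "card (snd ` ind ` T c) \<le> card ((\<lambda>q. \<lfloor>slope e y (u q) / m\<rfloor>) ` S)"
      using range(1)[of y] by (intro card_mono) (auto simp: ind_def \<beta>_def T_def)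
    ultimately show ?thesis using range(2)[OF disjI1[OF refl]] range(2)[OF disjI2[OF refl]] by linarith
  qed
  let ?D = "{0,1,2} \<times> {0,1,2} :: (int \<times> int) set"
  have mod3: "i mod 3 \<in> {0,1,2}" for i :: int by auto
  have "S \<subseteq> (\<Union>c\<in>?D. T c)" unfolding T_def using mod3 by blast
  then have "ind ` S \<subseteq> (\<Union>c\<in>?D. ind ` T c)" by blast
  moreover have finT: "finite (T c)" for c using fin by (simp add: T_def)
  ultimately have "card (ind ` S) \<le> card (\<Union>c\<in>?D. ind ` T c)"
    by (intro card_mono) auto
  also have "\<dots> \<le> (\<Sum>c\<in>?D. card (ind ` T c))"
    by (rule card_UN_le) simp
  finally have "real (card (ind ` S)) \<le> real (\<Sum>c\<in>?D. card (ind ` T c))"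
    by (simp only: of_nat_le_iff)
  also have "\<dots> = (\<Sum>c\<in>?D. real (card (ind ` T c)))" by (rule of_nat_sum)
  also have "\<dots> \<le> (\<Sum>c\<in>?D. 44 * (H * 2 ^ k))"
    using classes by (intro sum_mono)
  also have "\<dots> = 396 * (H * 2 ^ k)" by simp
  finally have ind: "real (card (ind ` S)) \<le> 396 * (H * 2 ^ k)" .
  have fb: "0 \<le> fibre_bound / (\<rho> * H)" using \<rho> Hpos by (simp add: fibre_bound_def)
  have "real (card S) \<le> real (card (ind ` S)) * (fibre_bound / (\<rho> * H))"
    by (rule card_le_image_times_fibre[OF fin fibre])
  also have "\<dots> \<le> 396 * (H * 2 ^ k) * (fibre_bound / (\<rho> * H))"
    using ind fb by (rule mult_right_mono)
  also have "\<dots> = 396 * fibre_bound * 2 ^ k / \<rho>" using Hpos \<rho> by (simp add: field_simps)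
  finally show ?thesis .
qed

text \<open>Here \<open>a\<close> is the distance of \<open>x\<close> and \<open>y\<close> times the side of a square: the squares with \<open>\<bar>orient x y\<bar> \<le> 4 * a\<close> lie
  in a strip around the line through \<open>x\<close> and \<open>y\<close>, and the others split into dyadic classes on each
  of its sides. Exchanging \<open>x\<close> and \<open>y\<close> exchanges the sides.\<close>

lemma card_squares_seen_from_both:
  fixes \<Gamma> :: "(real^2) set"
  assumes conn: "connected \<Gamma>" and x: "x \<in> X" and y: "y \<in> X" and ne: "x \<noteq> y"
    and xy: "closed_segment x y \<inter> \<Gamma> = {}" and fin: "finite S"
    and seen: "\<And>q. q \<in> S \<Longrightarrow> \<exists>u\<in>visible_part \<Gamma> x \<inter> Z. cell k u = q"
      "\<And>q. q \<in> S \<Longrightarrow> \<exists>v\<in>visible_part \<Gamma> y \<inter> Z. cell k v = q"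
    and J: "M \<le> 2 ^ J"
  shows "real (card S) \<le> (2450 * M * (4 * M + 2) + 792 * fibre_bound * (J + 1)) * (real k + 1) * 2 ^ k / dist x y"
proof (cases "S = {}")
  case True
  then show ?thesis using M_nonneg by (simp add: fibre_bound_def)
next
  case False
  then obtain q0 where q0: "q0 \<in> S" by blast
  obtain u where u: "\<And>q. q \<in> S \<Longrightarrow> u q \<in> visible_part \<Gamma> x \<inter> Z" "\<And>q. q \<in> S \<Longrightarrow> cell k (u q) = q"
    using seen(1) by metis
  obtain v where v: "\<And>q. q \<in> S \<Longrightarrow> v q \<in> visible_part \<Gamma> y \<inter> Z" "\<And>q. q \<in> S \<Longrightarrow> cell k (v q) = q"
    using seen(2) by metis
  have uZ: "u q \<in> Z" if "q \<in> S" for q using u(1)[OF that] by simp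
  note M0 = M_nonneg
  define \<rho> where "\<rho> = norm (y - x)"
  have \<rho>: "0 < \<rho>" using ne by (simp add: \<rho>_def)
  have \<rho>M: "\<rho> \<le> 2 * M"
  proof -
    have "y - x = (u q0 - x) - (u q0 - y)" by simp
    then have "\<rho> \<le> norm (u q0 - x) + norm (u q0 - y)" unfolding \<rho>_def by (metis norm_triangle_ineq4)
    then show ?thesis using near[OF x uZ[OF q0]] near[OF y uZ[OF q0]] by linarith
  qed
  define a where "a = \<rho> / 2 ^ k"
  have a: "0 < a" using \<rho> by (simp add: a_def)
  let ?o = "\<lambda>q. orient x y (u q)"
  have diff: "\<bar>?o q - orient x y (v q)\<bar> \<le> 2 * a" if q: "q \<in> S" for q
  proof -
    have "?o q - orient x y (v q) = det2 (y - x) (u q - v q)"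
      by (simp add: orient_def det2_def algebra_simps)
    also have "\<bar>\<dots>\<bar> \<le> norm (y - x) * norm (u q - v q)" by (rule abs_det2_le)
    also have "\<dots> \<le> \<rho> * (2 / 2 ^ k)"
      using dist_same_cell[of k "u q" "v q"] u(2)[OF q] v(2)[OF q] \<rho>
      unfolding \<rho>_def by (intro mult_left_mono) (simp_all add: dist_norm)
    finally show ?thesis by (simp add: a_def mult.commute)
  qed
  \<comment> \<open>Outside the strip, the heights of \<open>u q\<close> and \<open>v q\<close> have the same sign and are comparable by \<open>diff\<close>.\<close>
  define low where "low = {q \<in> S. \<bar>?o q\<bar> \<le> 4 * a}"
  define pos where "pos j = {q \<in> S. 4 * (a * 2 ^ j) \<le> ?o q \<and> ?o q \<le> 8 * (a * 2 ^ j)}" for j :: nat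
  define neg where "neg j = {q \<in> S. 4 * (a * 2 ^ j) \<le> - ?o q \<and> - ?o q \<le> 8 * (a * 2 ^ j)}" for j :: nat
  let ?C = "396 * fibre_bound * 2 ^ k / \<rho>"
  have aj: "a \<le> a * 2 ^ j" for j using a by simp
  have H: "2 / 2 ^ k \<le> 2 * 2 ^ j / (2 ^ k :: real)" for j by (intro divide_right_mono) simp_all
  have rH: "\<rho> * (2 * 2 ^ j / 2 ^ k) = 2 * (a * 2 ^ j)" "\<rho> * (5 * (2 * 2 ^ j / 2 ^ k)) = 10 * (a * 2 ^ j)" for j :: nat
    by (simp_all add: a_def)
  have cpos: "real (card (pos j)) \<le> ?C" for j
  proof (rule card_squares_seen_at_height[where u = u and v = v, OF conn x y xy _ _ _ _ _ \<rho>_def \<rho> H[of j]], goal_cases)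
    case (6 q)
    then show ?case unfolding rH pos_def using a aj[of j] by auto
  next
    case (7 q)
    then show ?case unfolding rH pos_def using a aj[of j] by auto
  next
    case (8 q)
    then have "4 * (a * 2 ^ j) \<le> ?o q" "\<bar>?o q - orient x y (v q)\<bar> \<le> 2 * a" using diff by (auto simp: pos_def)
    then show ?case unfolding rH using aj[of j] by linarith
  qed (use fin u v in \<open>auto simp: pos_def\<close>)
  have cneg: "real (card (neg j)) \<le> ?C" for j
  proof (rule card_squares_seen_at_height[where u = v and v = u, OF conn y x _ _ _ _ _ _ _ \<rho> H[of j]], goal_cases)
    case 1 then show ?case using xy by (simp add: closed_segment_commute)
  next
    case 7 then show ?case by (simp add: \<rho>_def norm_minus_commute)
  next
    case (8 q)
    then have "4 * (a * 2 ^ j) \<le> - ?o q" "\<bar>?o q - orient x y (v q)\<bar> \<le> 2 * a" using diff by (auto simp: neg_def)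
    then show ?case unfolding rH orient_swap[of y x] using aj[of j] by linarith
  next
    case (9 q)
    then have "- ?o q \<le> 8 * (a * 2 ^ j)" "\<bar>?o q - orient x y (v q)\<bar> \<le> 2 * a" using diff by (auto simp: neg_def)
    then show ?case unfolding rH orient_swap[of y x] using aj[of j] by linarith
  next
    case (10 q)
    then show ?case unfolding rH orient_swap[of y x] neg_def using a aj[of j] by auto
  qed (use fin u v in \<open>auto simp: neg_def\<close>)
  have clow: "real (card low) \<le> 2450 * M * (4 * M + 2) * 2 ^ k / \<rho>"
  proof (cases "low = {}")
    case True
    then show ?thesis using M0 \<rho> by simp
  next
    case False
    then obtain p where p: "p \<in> low" by blast
    then have pS: "p \<in> S" by (simp add: low_def)
    have "real (card low) \<le> (2 * (2 * M) * 2 ^ k + 2) * real ((2 * nat \<lceil>2 * 8 + 1 :: real\<rceil> + 1)\<^sup>2)"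
    proof (rule card_cells_tube[where z = "u p" and A = "y - x" and u = u])
      fix q assume q: "q \<in> low"
      then have qS: "q \<in> S" by (simp add: low_def)
      have "det2 (y - x) (u q - u p) = ?o q - ?o p"
        by (simp add: orient_def det2_def algebra_simps)
      moreover have "\<bar>?o q\<bar> \<le> 4 * a" "\<bar>?o p\<bar> \<le> 4 * a" using p q by (auto simp: low_def)
      ultimately have "\<bar>det2 (y - x) (u q - u p)\<bar> \<le> 8 * a" by linarith
      then show "\<bar>det2 (y - x) (u q - u p)\<bar> \<le> 8 / 2 ^ k * norm (y - x)"
        by (simp add: a_def \<rho>_def)
      have "norm (u q - u p) \<le> norm (u q - x) + norm (u p - x)"
        using norm_triangle_ineq4[of "u q - x" "u p - x"] by simp
      then show "norm (u q - u p) \<le> 2 * M" using near[OF x uZ[OF qS]] near[OF x uZ[OF pS]] by linarith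
      show "cell k (u q) = q" using u qS by simp
    qed (use fin ne M0 in \<open>auto simp: low_def\<close>)
    also have "(2 * nat \<lceil>2 * 8 + 1 :: real\<rceil> + 1)\<^sup>2 = 1225" by simp
    also have "(2 * (2 * M) * 2 ^ k + 2) * real 1225 \<le> (4 * M + 2) * 2 ^ k * 1225"
    proof -
      have "(1::real) \<le> 2 ^ k" by simp
      then show ?thesis by (simp add: algebra_simps)
    qed
    also have "\<dots> \<le> (4 * M + 2) * 2 ^ k * 1225 * (2 * M / \<rho>)"
    proof -
      have "1 \<le> 2 * M / \<rho>" using \<rho>M \<rho> by simp
      moreover have "0 \<le> (4 * M + 2) * 2 ^ k * 1225" using M0 by simp
      ultimately show ?thesis using mult_left_mono[of 1 "2 * M / \<rho>" "(4 * M + 2) * 2 ^ k * 1225"]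
        by (simp only: mult_1_right)
    qed
    also have "\<dots> = 2450 * M * (4 * M + 2) * 2 ^ k / \<rho>" by simp
    finally show ?thesis .
  qed
  have "S \<subseteq> low \<union> (\<Union>j\<le>k + J. pos j \<union> neg j)"
  proof
    fix q assume q: "q \<in> S"
    show "q \<in> low \<union> (\<Union>j\<le>k + J. pos j \<union> neg j)"
    proof (cases "\<bar>?o q\<bar> \<le> 4 * a")
      case True then show ?thesis using q by (simp add: low_def)
    next
      case False
      have "\<bar>?o q\<bar> \<le> norm (y - x) * norm (u q - x)" unfolding orient_def by (rule abs_det2_le)
      also have "\<dots> \<le> \<rho> * 2 ^ J" using near[OF x uZ[OF q]] J \<rho> by (intro mult_mono) (auto simp: \<rho>_def)
      also have "\<dots> = a * 2 ^ (k + J)" by (simp add: a_def power_add)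
      finally have "\<bar>?o q\<bar> \<le> a * 2 ^ (k + J)" .
      moreover have "0 \<le> a * 2 ^ (k + J)" using a by simp
      ultimately have "\<bar>?o q\<bar> \<le> 4 * a * 2 ^ (k + J)" unfolding mult.assoc by linarith
      then have "\<bar>?o q\<bar> / (4 * a) \<le> 2 ^ (k + J)" using a by (simp add: pos_divide_le_eq mult_ac)
      moreover have "1 \<le> \<bar>?o q\<bar> / (4 * a)" using a False by simp
      ultimately obtain j where j: "j \<le> k + J" "2 ^ j \<le> \<bar>?o q\<bar> / (4 * a)" "\<bar>?o q\<bar> / (4 * a) \<le> 2 ^ Suc j"
        using dyadic_bracket by blast
      then have "4 * (a * 2 ^ j) \<le> \<bar>?o q\<bar>" "\<bar>?o q\<bar> \<le> 8 * (a * 2 ^ j)"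
        using a by (simp_all add: pos_divide_le_eq pos_le_divide_eq mult_ac)
      then have "q \<in> pos j \<union> neg j" using q by (auto simp: pos_def neg_def abs_if split: if_splits)
      then show ?thesis using j(1) by blast
    qed
  qed
  moreover have finc: "finite low" "\<And>j. finite (pos j)" "\<And>j. finite (neg j)"
    using fin by (auto simp: low_def pos_def neg_def)
  ultimately have "card S \<le> card (low \<union> (\<Union>j\<le>k + J. pos j \<union> neg j))"
    by (intro card_mono) auto
  also have "\<dots> \<le> card low + card (\<Union>j\<le>k + J. pos j \<union> neg j)" by (rule card_Un_le)
  also have "\<dots> \<le> card low + (\<Sum>j\<le>k + J. card (pos j \<union> neg j))"
    by (intro add_left_mono card_UN_le) simp
  also have "\<dots> \<le> card low + (\<Sum>j\<le>k + J. card (pos j) + card (neg j))"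
    by (intro add_left_mono sum_mono card_Un_le)
  finally have "real (card S) \<le> real (card low) + (\<Sum>j\<le>k + J. real (card (pos j)) + real (card (neg j)))"
    by (simp flip: of_nat_sum of_nat_add)
  also have "\<dots> \<le> 2450 * M * (4 * M + 2) * 2 ^ k / \<rho> + (\<Sum>j\<le>k + J. ?C + ?C)"
    by (intro add_mono sum_mono clow cpos cneg)
  also have "\<dots> = 2450 * M * (4 * M + 2) * 2 ^ k / \<rho> + 2 * (k + J + 1) * ?C" by simp
  also have "\<dots> = (2450 * M * (4 * M + 2) + 792 * fibre_bound * (real k + J + 1)) * (2 ^ k / \<rho>)"
    using \<rho> by (simp add: field_simps)
  also have "\<dots> \<le> ((2450 * M * (4 * M + 2)) * (real k + 1) + 792 * fibre_bound * ((J + 1) * (real k + 1))) * (2 ^ k / \<rho>)"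
  proof (intro mult_right_mono add_mono mult_left_mono)
    have "2450 * M * (4 * M + 2) * 1 \<le> 2450 * M * (4 * M + 2) * (real k + 1)"
      using M0 by (intro mult_left_mono) auto
    then show "2450 * M * (4 * M + 2) \<le> 2450 * M * (4 * M + 2) * (real k + 1)" by simp
    show "real k + real J + 1 \<le> real (J + 1) * (real k + 1)" by (simp add: algebra_simps)
  qed (use \<rho> in \<open>auto simp: fibre_bound_def\<close>)
  also have "\<dots> = (2450 * M * (4 * M + 2) + 792 * fibre_bound * (J + 1)) * (real k + 1) * 2 ^ k / dist x y"
  proof -
    have "dist x y = \<rho>" by (simp add: \<rho>_def dist_norm norm_minus_commute)
    moreover have "(c1 * K + c2 * (j * K)) * (p / \<rho>) = (c1 + c2 * j) * K * p / \<rho>" for c1 c2 K j p :: real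
      by (simp add: algebra_simps add_divide_distrib)
    ultimately show ?thesis by (simp only:)
  qed
  finally show ?thesis .
qed

end

section \<open>Weights on the dyadic tree\<close>

lemma content_inf_cell:
  assumes "0 < t" "X \<subseteq> {z. cell j z = q}"
  shows "content_inf t X \<le> ennreal (2 powr t * (2 powr (-t)) ^ j)"
proof (cases "X = {}")
  case True
  then show ?thesis by (simp add: content_inf_empty assms(1))
next
  case False
  have d: "dist u v \<le> 2 / 2 ^ j" if "u \<in> X" "v \<in> X" for u v
    using that assms(2) by (intro dist_same_cell) auto
  have bdd: "bounded X" using d unfolding bounded_two_points by blast
  have "content_inf t X \<le> ennreal (diameter X powr t)"
    by (rule content_inf_bounded[OF bdd assms(1)])
  also have "\<dots> \<le> ennreal ((2 / 2 ^ j) powr t)"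
  proof (intro ennreal_leI powr_mono2)
    show "diameter X \<le> 2 / 2 ^ j" by (rule diameter_le) (use d in \<open>auto simp: dist_norm\<close>)
  qed (use assms bdd diameter_ge_0 in auto)
  also have "(2 / 2 ^ j) powr t = 2 powr t * (2 powr (-t)) ^ j"
  proof -
    have "(2::real) / 2 ^ j = 2 powr (1 - real j)" by (simp add: powr_diff powr_realpow)
    moreover have "(2 powr (-t)) ^ j = 2 powr (- t * real j)" by (simp add: powr_powr flip: powr_realpow)
    ultimately show ?thesis by (simp add: powr_powr algebra_simps flip: powr_add)
  qed
  finally show ?thesis .
qed

text \<open>A mass is built upwards from the finest squares: a square of side \<open>1 / 2 ^ j\<close> receives the masses
  of its four parts, scaled down when the total exceeds the allowance \<open>(2 powr (-t)) ^ j\<close>. If nothing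
  is scaled, the content is bounded by that of the parts; if the mass is scaled, it equals the
  allowance, and the square itself is a cover of that cost.\<close>

lemma discrete_frostman:
  assumes t: "0 < t" and "j \<le> n" and "X \<subseteq> {z. cell j z = q}"
  shows "\<exists>T w. finite T \<and> T \<subseteq> X \<and> (\<forall>z. 0 \<le> w z) \<and>
      (\<forall>i c. j \<le> i \<and> i \<le> n \<longrightarrow> (\<Sum>z | z \<in> T \<and> cell i z = c. w z) \<le> (2 powr (-t)) ^ i) \<and>
      content_inf t X \<le> ennreal (2 powr t * (\<Sum>z\<in>T. w z))"
  using assms(2,3)
proof (induction arbitrary: X q rule: inc_induct)
  case base
  show ?case
  proof (cases "X = {}")
    case True
    then show ?thesis by (intro exI[of _ "{}"] exI[of _ "\<lambda>_. 0"]) (simp add: content_inf_empty t)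
  next
    case False
    then obtain z0 where z0: "z0 \<in> X" by blast
    have "(\<Sum>z | z \<in> {z0} \<and> cell i z = c. (2 powr (-t)) ^ n) \<le> (2 powr (-t)) ^ n" for i c
      by (cases "cell i z0 = c") (auto simp: conj_commute cong: conj_cong)
    then show ?thesis
      using z0 content_inf_cell[OF t base]
      by (intro exI[of _ "{z0}"] exI[of _ "\<lambda>_. (2 powr (-t)) ^ n"]) auto
  qed
next
  case (step j)
  let ?\<theta> = "2 powr (-t)"
  define C where "C = cell (Suc j) ` X"
  have finC: "finite C"
  proof (cases "X = {}")
    case False
    then obtain u where u: "u \<in> X" by blast
    have "dist u v \<le> real 4 / 2 ^ Suc j" if "v \<in> X" for v
      using dist_same_cell[of j u v] u that step.prems by auto
    then show ?thesis unfolding C_def by (rule card_near_cells(1)[where u = u])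
  qed (simp add: C_def)
  let ?X = "\<lambda>c. {z \<in> X. cell (Suc j) z = c}"
  define Q where "Q c T w \<longleftrightarrow> finite T \<and> T \<subseteq> ?X c \<and> (\<forall>z. 0 \<le> w z) \<and>
      (\<forall>i d. Suc j \<le> i \<and> i \<le> n \<longrightarrow> (\<Sum>z | z \<in> T \<and> cell i z = d. w z) \<le> ?\<theta> ^ i) \<and>
      content_inf t (?X c) \<le> ennreal (2 powr t * (\<Sum>z\<in>T. w z))" for c T w
  have "\<exists>T w. Q c T w" for c
    unfolding Q_def by (rule step.IH[of _ c]) auto
  then obtain T w where Q: "\<And>c. Q c (T c) (w c)" by metis
  have T: "finite (T c)" "T c \<subseteq> ?X c" and w: "0 \<le> w c z"
    and cont: "content_inf t (?X c) \<le> ennreal (2 powr t * (\<Sum>z\<in>T c. w c z))" for c z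
    using Q[of c] unfolding Q_def by blast+
  have Tw: "(\<Sum>z | z \<in> T c \<and> cell i z = d. w c z) \<le> ?\<theta> ^ i" if "Suc j \<le> i" "i \<le> n" for c i d
    using Q[of c] that unfolding Q_def by blast
  define T' where "T' = (\<Union>c\<in>C. T c)"
  define w' where "w' z = w (cell (Suc j) z) z" for z
  define W where "W = (\<Sum>z\<in>T'. w' z)"
  have finT': "finite T'" using finC T(1) by (simp add: T'_def)
  have T'X: "T' \<subseteq> X" using T(2) unfolding T'_def by blast
  have w'0: "0 \<le> w' z" for z by (simp add: w'_def w)
  have w'T: "w' z = w c z" if "z \<in> T c" for z c using that T(2)[of c] by (auto simp: w'_def)
  have W: "W = (\<Sum>c\<in>C. \<Sum>z\<in>T c. w c z)"
  proof -
    have "W = (\<Sum>c\<in>C. \<Sum>z\<in>T c. w' z)"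
      unfolding W_def T'_def using finC T by (intro sum.UNION_disjoint) blast+
    also have "\<dots> = (\<Sum>c\<in>C. \<Sum>z\<in>T c. w c z)" using w'T by (intro sum.cong refl)
    finally show ?thesis .
  qed
  have W0: "0 \<le> W" unfolding W_def using w'0 by (intro sum_nonneg)
  have level: "(\<Sum>z | z \<in> T' \<and> cell i z = d. w' z) \<le> ?\<theta> ^ i" if i: "Suc j \<le> i" "i \<le> n" for i d
  proof (cases "\<exists>z0\<in>T'. cell i z0 = d")
    case False
    then have empty: "{z. z \<in> T' \<and> cell i z = d} = {}" by blast
    show ?thesis unfolding empty by simp
  next
    case True
    then obtain z0 where z0: "z0 \<in> T'" "cell i z0 = d" by blast
    let ?c = "cell (Suc j) z0"
    have "z \<in> T ?c" if zT: "z \<in> T'" "cell i z = d" for z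
    proof -
      have "cell i z = cell i z0" using zT(2) z0(2) by simp
      then have "cell (Suc j) z = ?c" using i(1) by (rule cell_ancestor)
      moreover obtain c where "z \<in> T c" using zT(1) unfolding T'_def by blast
      ultimately show ?thesis using T(2)[of c] by auto
    qed
    then have "(\<Sum>z | z \<in> T' \<and> cell i z = d. w' z) \<le> (\<Sum>z | z \<in> T ?c \<and> cell i z = d. w' z)"
      using T(1) w'0 by (intro sum_mono2) auto
    also have "\<dots> = (\<Sum>z | z \<in> T ?c \<and> cell i z = d. w ?c z)" using w'T by (intro sum.cong refl) auto
    also have "\<dots> \<le> ?\<theta> ^ i" by (rule Tw[OF i])
    finally show ?thesis .
  qed
  have cell_le: "(\<Sum>z | z \<in> T' \<and> cell i z = d. w' z) \<le> W" for i d
    unfolding W_def using finT' w'0 by (intro sum_mono2) auto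
  show ?case
  proof (cases "W \<le> ?\<theta> ^ j")
    case True
    have "X = (\<Union>c\<in>C. ?X c)" by (auto simp: C_def)
    then have "content_inf t X \<le> (\<Sum>c\<in>C. content_inf t (?X c))"
      using content_inf_finite_UN[OF t finC, of ?X] by simp
    also have "\<dots> \<le> (\<Sum>c\<in>C. ennreal (2 powr t * (\<Sum>z\<in>T c. w c z)))"
      by (intro sum_mono cont)
    also have "\<dots> = ennreal (\<Sum>c\<in>C. 2 powr t * (\<Sum>z\<in>T c. w c z))"
      using w by (intro sum_ennreal mult_nonneg_nonneg sum_nonneg) auto
    also have "(\<Sum>c\<in>C. 2 powr t * (\<Sum>z\<in>T c. w c z)) = 2 powr t * W"
      by (simp add: W sum_distrib_left)
    finally have content: "content_inf t X \<le> ennreal (2 powr t * W)" .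
    have "(\<Sum>z | z \<in> T' \<and> cell i z = d. w' z) \<le> ?\<theta> ^ i" if "j \<le> i" "i \<le> n" for i d
    proof (cases "i = j")
      case True
      then show ?thesis using cell_le[of i d] \<open>W \<le> ?\<theta> ^ j\<close> by simp
    next
      case False
      then show ?thesis using that level[of i d] by simp
    qed
    then show ?thesis using finT' T'X w'0 content unfolding W_def by blast
  next
    case False
    moreover have "0 < ?\<theta> ^ j" by simp
    ultimately have Wpos: "?\<theta> ^ j < W" "0 < W" by linarith+
    then have W': "?\<theta> ^ j / W \<le> 1" "W > 0" by (simp_all add: divide_le_eq)
    define w2 where "w2 z = w' z * (?\<theta> ^ j / W)" for z
    have le: "w2 z \<le> w' z" for z
      unfolding w2_def using W' w'0[of z] by (intro mult_left_le) auto
    have sumw2: "(\<Sum>z\<in>A. w2 z) = (\<Sum>z\<in>A. w' z) * (?\<theta> ^ j / W)" for A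
      by (simp only: w2_def sum_distrib_right)
    have tot: "(\<Sum>z\<in>T'. w2 z) = ?\<theta> ^ j" unfolding sumw2 W_def[symmetric] using W' by simp
    have "(\<Sum>z | z \<in> T' \<and> cell i z = d. w2 z) \<le> ?\<theta> ^ i" if "j \<le> i" "i \<le> n" for i d
    proof (cases "i = j")
      case True
      have "(\<Sum>z | z \<in> T' \<and> cell i z = d. w2 z) \<le> (\<Sum>z\<in>T'. w2 z)"
        using finT' w'0 W' by (intro sum_mono2) (auto simp: w2_def)
      then show ?thesis using True tot by simp
    next
      case False
      have "(\<Sum>z | z \<in> T' \<and> cell i z = d. w2 z) \<le> (\<Sum>z | z \<in> T' \<and> cell i z = d. w' z)"
        by (intro sum_mono le)
      then show ?thesis using False that level[of i d] by simp
    qed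
    moreover have "content_inf t X \<le> ennreal (2 powr t * (\<Sum>z\<in>T'. w2 z))"
      unfolding tot by (rule content_inf_cell[OF t step.prems])
    moreover have "\<forall>z. 0 \<le> w2 z" using w'0 W' by (simp add: w2_def)
    ultimately show ?thesis using finT' T'X by blast
  qed
qed

lemma frostman_ball:
  fixes w :: "real^2 \<Rightarrow> real"
  assumes "finite T" "\<And>z. 0 \<le> w z"
    and "\<And>c. (\<Sum>z | z \<in> T \<and> cell l z = c. w z) \<le> \<theta>"
  shows "(\<Sum>y | y \<in> T \<and> dist x y \<le> 2 / 2 ^ l. w y) \<le> 25 * \<theta>"
proof -
  let ?A = "{y. y \<in> T \<and> dist x y \<le> 2 / 2 ^ l}"
  have "0 \<le> (\<Sum>z | z \<in> T \<and> cell l z = cell l x. w z)" by (intro sum_nonneg assms(2))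
  then have \<theta>: "0 \<le> \<theta>" using assms(3) by (rule order_trans)
  have finA: "finite ?A" using assms(1) by simp
  have "(\<Sum>y\<in>?A. w y) = (\<Sum>c\<in>cell l ` ?A. \<Sum>y | y \<in> ?A \<and> cell l y = c. w y)"
    by (rule sum.image_gen[OF finA])
  also have "\<dots> \<le> (\<Sum>c\<in>cell l ` ?A. \<theta>)"
  proof (rule sum_mono)
    fix c
    have "(\<Sum>y | y \<in> ?A \<and> cell l y = c. w y) \<le> (\<Sum>z | z \<in> T \<and> cell l z = c. w z)"
      using assms(1,2) by (intro sum_mono2) auto
    then show "(\<Sum>y | y \<in> ?A \<and> cell l y = c. w y) \<le> \<theta>" using assms(3)[of c] by linarith
  qed
  also have "\<dots> = real (card (cell l ` ?A)) * \<theta>" by simp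
  also have "\<dots> \<le> 25 * \<theta>"
  proof (rule mult_right_mono[OF _ \<theta>])
    have "card (cell l ` ?A) \<le> (2 * 2 + 1)\<^sup>2"
      by (rule card_near_cells(2)[where u = x]) auto
    then show "real (card (cell l ` ?A)) \<le> 25" by simp
  qed
  finally show ?thesis .
qed

section \<open>The second moment argument\<close>

text \<open>Cauchy--Schwarz for \<open>f q\<close>, the total weight of the points \<open>x\<close> with \<open>q \<in> V x\<close>. Its sum
  over \<open>S\<close> is the total weight times \<open>m\<close>, and its sum of squares counts the overlaps.\<close>

lemma weighted_overlap:
  fixes w :: "'a \<Rightarrow> real" and V :: "'a \<Rightarrow> 'b set"
  assumes fin: "finite T" "finite S" and V: "\<And>x. x \<in> T \<Longrightarrow> V x \<subseteq> S" "\<And>x. x \<in> T \<Longrightarrow> card (V x) = m"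
    and w: "\<And>x. 0 \<le> w x"
    and B0: "0 \<le> B" and B: "\<And>x. x \<in> T \<Longrightarrow> (\<Sum>y\<in>T. w y * card (V x \<inter> V y)) \<le> B"
  shows "(\<Sum>x\<in>T. w x) * real m ^ 2 \<le> real (card S) * B"
proof (cases "(\<Sum>x\<in>T. w x) = 0")
  case True
  then show ?thesis using B0 by simp
next
  case False
  let ?W = "\<Sum>x\<in>T. w x"
  have W: "0 < ?W" using False w by (simp add: sum_nonneg order_less_le)
  define f where "f q = (\<Sum>x\<in>T. w x * of_bool (q \<in> V x))" for q
  have count: "(\<Sum>q\<in>S. of_bool (q \<in> A)) = real (card A)" if "A \<subseteq> S" for A
    using fin(2) that by (simp add: of_bool_def sum.If_cases Int_absorb1)
  have "(\<Sum>q\<in>S. f q) = (\<Sum>x\<in>T. \<Sum>q\<in>S. w x * of_bool (q \<in> V x))"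
    unfolding f_def by (rule sum.swap)
  also have "\<dots> = (\<Sum>x\<in>T. w x * (\<Sum>q\<in>S. of_bool (q \<in> V x)))" by (simp only: sum_distrib_left)
  also have "\<dots> = (\<Sum>x\<in>T. w x * real m)" using count V by (intro sum.cong refl) simp
  also have "\<dots> = ?W * real m" by (simp only: sum_distrib_right)
  finally have first: "(\<Sum>q\<in>S. f q) = ?W * real m" .
  have "(\<Sum>q\<in>S. (f q)\<^sup>2) = (\<Sum>q\<in>S. \<Sum>x\<in>T. \<Sum>y\<in>T. w x * (w y * of_bool (q \<in> V x \<inter> V y)))"
    unfolding f_def power2_eq_square sum_product
    by (intro sum.cong refl) (simp add: of_bool_conj)
  also have "\<dots> = (\<Sum>x\<in>T. \<Sum>q\<in>S. \<Sum>y\<in>T. w x * (w y * of_bool (q \<in> V x \<inter> V y)))"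
    by (rule sum.swap)
  also have "\<dots> = (\<Sum>x\<in>T. \<Sum>y\<in>T. \<Sum>q\<in>S. w x * (w y * of_bool (q \<in> V x \<inter> V y)))"
    by (intro sum.cong refl sum.swap)
  also have "\<dots> = (\<Sum>x\<in>T. w x * (\<Sum>y\<in>T. w y * (\<Sum>q\<in>S. of_bool (q \<in> V x \<inter> V y))))"
    by (simp only: sum_distrib_left)
  also have "\<dots> = (\<Sum>x\<in>T. w x * (\<Sum>y\<in>T. w y * card (V x \<inter> V y)))"
    using V(1) by (intro sum.cong refl arg_cong2[where f = "(*)"] count) blast
  also have "\<dots> \<le> (\<Sum>x\<in>T. w x * B)"
    using B w by (intro sum_mono mult_left_mono)
  also have "\<dots> = ?W * B" by (simp only: sum_distrib_right)
  finally have second: "(\<Sum>q\<in>S. (f q)\<^sup>2) \<le> ?W * B" .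
  have "(?W * real m)\<^sup>2 \<le> (\<Sum>q\<in>S. (f q)\<^sup>2) * real (card S)"
    unfolding first[symmetric] by (rule sum_squared_le_sum_of_squares)
  also have "\<dots> \<le> (?W * B) * real (card S)" using second by (rule mult_right_mono) simp
  finally have "?W * (?W * real m ^ 2) \<le> ?W * (real (card S) * B)"
    by (simp add: power2_eq_square mult_ac)
  then show ?thesis using W by simp
qed

text \<open>The second moment argument at scale \<open>1 / 2 ^ k\<close>, where \<open>V x\<close> stands for the set of squares seen from
  \<open>x\<close>. The mass is resolved down to distances \<open>1 / 2 ^ n\<close> with \<open>n\<close> close to \<open>k * (\<sigma> - 1)\<close>, which is
  where the pair bound \<open>2 ^ k / dist x y\<close> reaches the number \<open>2 powr (k * \<sigma>)\<close> of squares
  per viewpoint. At larger distances, the contributions \<open>2 ^ l * (2 powr (-t)) ^ l\<close> of the dyadic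
  distances \<open>1 / 2 ^ l\<close> increase with \<open>l\<close> because \<open>t < 1\<close>.\<close>

lemma content_of_rich_viewpoints:
  fixes V :: "real^2 \<Rightarrow> 'b set"
  assumes t: "0 < t" "t < 1" and \<sigma>: "1 < \<sigma>" "\<sigma> \<le> 2" and A: "0 \<le> A"
    and S: "finite S" "real (card S) \<le> 2 powr (k * \<delta>)"
    and Y: "Y \<subseteq> {z. cell 0 z = q0}"
    and V: "\<And>x. x \<in> Y \<Longrightarrow> V x \<subseteq> S" "\<And>x. x \<in> Y \<Longrightarrow> 2 powr (k * \<sigma>) \<le> real (card (V x))"
    and pair: "\<And>x y. x \<in> Y \<Longrightarrow> y \<in> Y \<Longrightarrow> x \<noteq> y \<Longrightarrow>
        real (card (V x \<inter> V y)) \<le> A * (real k + 1) * 2 ^ k / dist x y"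
  shows "content_inf t Y \<le> ennreal (50 * (A + 4) * (real k + 1)\<^sup>2 * 2 powr (k * (\<delta> - \<sigma> - t * (\<sigma> - 1))))"
proof -
  define m where "m = nat \<lceil>2 powr (k * \<sigma>)\<rceil>"
  have m: "2 powr (k * \<sigma>) \<le> real m" "real m \<le> 2 * 2 powr (k * \<sigma>)"
  proof -
    show "2 powr (k * \<sigma>) \<le> real m" unfolding m_def by (rule real_nat_ceiling_ge)
    have "2 powr 0 \<le> 2 powr (k * \<sigma>)" using \<sigma> by (intro powr_mono) auto
    then have "1 \<le> 2 powr (k * \<sigma>)" by simp
    moreover have "real m \<le> 2 powr (k * \<sigma>) + 1" unfolding m_def by (simp add: of_nat_ceiling less_imp_le)
    ultimately show "real m \<le> 2 * 2 powr (k * \<sigma>)" by linarith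
  qed
  have "\<exists>V'. V' \<subseteq> V x \<and> card V' = m" if x: "x \<in> Y" for x
  proof -
    have "m \<le> card (V x)" using V(2)[OF x] unfolding m_def by (simp add: nat_le_iff ceiling_le_iff)
    then show ?thesis by (meson obtain_subset_with_card_n)
  qed
  then obtain V' where V': "\<And>x. x \<in> Y \<Longrightarrow> V' x \<subseteq> V x" "\<And>x. x \<in> Y \<Longrightarrow> card (V' x) = m" by metis
  have finV: "finite (V x)" if "x \<in> Y" for x using V(1)[OF that] S(1) finite_subset by blast
  define n where "n = nat \<lfloor>k * (\<sigma> - 1)\<rfloor>"
  have ks: "0 \<le> k * (\<sigma> - 1)" using \<sigma> by simp
  have n: "real n \<le> k * (\<sigma> - 1)" "k * (\<sigma> - 1) - 1 \<le> real n"
    using ks unfolding n_def by linarith+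
  have "k * (\<sigma> - 1) \<le> real k * 1" using \<sigma> by (intro mult_left_mono) auto
  then have nk: "real n \<le> real k" using n by simp
  define \<theta> where "\<theta> = 2 powr (- t)"
  obtain T w where Tw: "finite T \<and> T \<subseteq> Y \<and> (\<forall>z. 0 \<le> (w z :: real)) \<and>
      (\<forall>i c. 0 \<le> i \<and> i \<le> n \<longrightarrow> (\<Sum>z | z \<in> T \<and> cell i z = c. w z) \<le> \<theta> ^ i) \<and>
      content_inf t Y \<le> ennreal (2 powr t * (\<Sum>z\<in>T. w z))"
    using discrete_frostman[OF t(1) le0 Y, of n] unfolding \<theta>_def by (elim exE)
  then have T: "finite T" "T \<subseteq> Y" and w: "\<And>z. 0 \<le> w z"
    and cont: "content_inf t Y \<le> ennreal (2 powr t * (\<Sum>z\<in>T. w z))" by blast+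
  have fr: "(\<Sum>z | z \<in> T \<and> cell i z = c. w z) \<le> \<theta> ^ i" if "i \<le> n" for i c
    using Tw that by blast
  define P where "P = A * (real k + 1) * 2 ^ k"
  have P: "0 \<le> P" using A by (simp add: P_def)
  define E where "E = 2 powr (k * (\<sigma> - t * (\<sigma> - 1)))"
  define B where "B = (\<Sum>l\<le>n. P * 2 ^ l * (25 * \<theta> ^ l)) + real m * (25 * \<theta> ^ n)"
  have B0: "0 \<le> B" unfolding B_def using P by (intro add_nonneg_nonneg sum_nonneg) (auto simp: \<theta>_def)
  \<comment> \<open>Every \<open>y\<close> is either within the resolution of the mass or at a distance comparable with one of the
    coarser dyadic scales, where the pair bound is used.\<close>
  have energy: "(\<Sum>y\<in>T. w y * card (V' x \<inter> V' y)) \<le> B" if x: "x \<in> T" for x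
  proof -
    have xY: "x \<in> Y" using x T by blast
    have pt: "real (card (V' x \<inter> V' y)) \<le>
        (\<Sum>l\<le>n. P * 2 ^ l * of_bool (dist x y \<le> 2 / 2 ^ l)) + real m * of_bool (dist x y \<le> 2 / 2 ^ n)"
      if y: "y \<in> T" for y
    proof (cases "dist x y \<le> 2 / 2 ^ n")
      case True
      have "card (V' x \<inter> V' y) \<le> card (V' x)"
        using V'(1)[OF xY] finV[OF xY] by (intro card_mono) (auto intro: finite_subset)
      then have "real (card (V' x \<inter> V' y)) \<le> real m * of_bool (dist x y \<le> 2 / 2 ^ n)"
        using V'(2)[OF xY] True by simp
      moreover have "0 \<le> (\<Sum>l\<le>n. P * 2 ^ l * of_bool (dist x y \<le> 2 / 2 ^ l))"
        using P by (intro sum_nonneg) simp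
      ultimately show ?thesis by linarith
    next
      case False
      have yY: "y \<in> Y" using y T by blast
      have d: "dist x y \<le> 2" using dist_same_cell[of 0 x y] xY yY Y by auto
      have "0 < (2::real) / 2 ^ n" by simp
      then have dpos: "0 < dist x y" using False by linarith
      have g: "1 \<le> 2 / dist x y" "2 / dist x y \<le> 2 ^ n"
        using d dpos False by (auto simp: field_simps)
      obtain l where l: "l \<le> n" "2 ^ l \<le> 2 / dist x y" "2 / dist x y \<le> 2 ^ Suc l"
        using dyadic_bracket[OF g] by blast
      have near: "dist x y \<le> 2 / 2 ^ l" using l(2) dpos by (simp add: field_simps)
      have inv: "1 / dist x y \<le> 2 ^ l" using l(3) by simp
      have "card (V' x \<inter> V' y) \<le> card (V x \<inter> V y)"
        using V'(1)[OF xY] V'(1)[OF yY] finV[OF xY] by (intro card_mono) auto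
      then have "real (card (V' x \<inter> V' y)) \<le> P * (1 / dist x y)"
        using pair[OF xY yY] dpos by (simp add: P_def)
      also have "\<dots> \<le> P * 2 ^ l" using inv P by (rule mult_left_mono)
      also have "\<dots> = P * 2 ^ l * of_bool (dist x y \<le> 2 / 2 ^ l)" using near by simp
      also have "\<dots> \<le> (\<Sum>l\<le>n. P * 2 ^ l * of_bool (dist x y \<le> 2 / 2 ^ l))"
        using l(1) P by (intro member_le_sum) auto
      finally show ?thesis by simp
    qed
    have ball: "(\<Sum>y\<in>T. w y * of_bool (dist x y \<le> 2 / 2 ^ l)) \<le> 25 * \<theta> ^ l" if l: "l \<le> n" for l
    proof -
      have "(\<Sum>y\<in>T. w y * of_bool (dist x y \<le> 2 / 2 ^ l)) = (\<Sum>y | y \<in> T \<and> dist x y \<le> 2 / 2 ^ l. w y)"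
        using T(1) by (simp add: of_bool_def if_distrib sum.If_cases Int_def cong: if_cong)
      also have "\<dots> \<le> 25 * \<theta> ^ l" by (rule frostman_ball[OF T(1) w fr[OF l]])
      finally show ?thesis .
    qed
    have "(\<Sum>y\<in>T. w y * card (V' x \<inter> V' y)) \<le>
      (\<Sum>y\<in>T. w y * ((\<Sum>l\<le>n. P * 2 ^ l * of_bool (dist x y \<le> 2 / 2 ^ l)) + real m * of_bool (dist x y \<le> 2 / 2 ^ n)))"
      using pt w by (intro sum_mono mult_left_mono) auto
    also have "\<dots> = (\<Sum>y\<in>T. (\<Sum>l\<le>n. P * 2 ^ l * (w y * of_bool (dist x y \<le> 2 / 2 ^ l)))) +
        (\<Sum>y\<in>T. real m * (w y * of_bool (dist x y \<le> 2 / 2 ^ n)))"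
      by (simp only: distrib_left sum.distrib sum_distrib_left mult.left_commute mult.commute mult.assoc)
    also have "\<dots> = (\<Sum>l\<le>n. P * 2 ^ l * (\<Sum>y\<in>T. w y * of_bool (dist x y \<le> 2 / 2 ^ l))) +
        real m * (\<Sum>y\<in>T. w y * of_bool (dist x y \<le> 2 / 2 ^ n))"
      by (subst sum.swap) (simp only: sum_distrib_left)
    also have "\<dots> \<le> B"
      unfolding B_def using ball P by (intro add_mono sum_mono mult_left_mono) auto
    finally show ?thesis .
  qed
  have \<theta>n: "\<theta> ^ l = 2 powr (- t * l)" for l
    by (simp add: \<theta>_def powr_powr flip: powr_realpow)
  have two: "(2::real) ^ l = 2 powr l" for l by (simp add: powr_realpow)
  have BE: "B \<le> 25 * (A + 4) * (real k + 1)\<^sup>2 * E"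
  proof -
    have "P * 2 ^ l * (25 * \<theta> ^ l) \<le> 25 * A * (real k + 1) * E" if l: "l \<le> n" for l
    proof -
      have "2 ^ k * 2 ^ l * \<theta> ^ l = 2 powr (k + (1 - t) * l)"
        unfolding two \<theta>n by (simp add: algebra_simps flip: powr_add)
      also have "\<dots> \<le> 2 powr (k + (1 - t) * (k * (\<sigma> - 1)))"
        using l n t by (intro powr_mono add_left_mono mult_left_mono) auto
      also have "\<dots> = E" unfolding E_def by (simp add: algebra_simps)
      finally have "25 * A * (real k + 1) * (2 ^ k * 2 ^ l * \<theta> ^ l) \<le> 25 * A * (real k + 1) * E"
        using A by (intro mult_left_mono) auto
      then show ?thesis by (simp only: P_def mult_ac)
    qed
    then have "(\<Sum>l\<le>n. P * 2 ^ l * (25 * \<theta> ^ l)) \<le> (\<Sum>l\<le>n. 25 * A * (real k + 1) * E)"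
      by (intro sum_mono) auto
    also have "\<dots> = (real n + 1) * (25 * A * (real k + 1) * E)" by (simp add: algebra_simps)
    also have "\<dots> \<le> (real k + 1) * (25 * A * (real k + 1) * E)"
      using nk A by (intro mult_right_mono) (auto simp: E_def)
    finally have 1: "(\<Sum>l\<le>n. P * 2 ^ l * (25 * \<theta> ^ l)) \<le> 25 * A * (real k + 1)\<^sup>2 * E"
      by (simp add: power2_eq_square mult_ac)
    have "\<theta> ^ n \<le> 2 powr (1 - t * (k * (\<sigma> - 1)))"
    proof -
      have "t * (k * (\<sigma> - 1) - 1) \<le> t * real n" using n t by (intro mult_left_mono) auto
      then have "- t * n \<le> 1 - t * (k * (\<sigma> - 1))" using t by (simp add: algebra_simps)
      then show ?thesis unfolding \<theta>n by (intro powr_mono) auto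
    qed
    then have "real m * (25 * \<theta> ^ n) \<le> (2 * 2 powr (k * \<sigma>)) * (25 * 2 powr (1 - t * (k * (\<sigma> - 1))))"
      using m by (intro mult_mono) (auto simp: \<theta>_def)
    also have "\<dots> = 100 * E"
      unfolding E_def by (simp add: algebra_simps powr_add powr_diff)
    also have "\<dots> \<le> 100 * E * (real k + 1)\<^sup>2"
      by (simp add: E_def mult_le_cancel_left1)
    finally have "real m * (25 * \<theta> ^ n) \<le> 100 * E * (real k + 1)\<^sup>2" .
    then show ?thesis using 1 unfolding B_def by (simp add: algebra_simps)
  qed
  have "(\<Sum>x\<in>T. w x) * real m ^ 2 \<le> real (card S) * B"
  proof (rule weighted_overlap[OF T(1) S(1) _ _ w B0 energy])
    show "V' x \<subseteq> S" "card (V' x) = m" if "x \<in> T" for x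
      using that T(2) V'(1)[of x] V(1)[of x] V'(2)[of x] by auto
  qed
  also have "\<dots> \<le> 2 powr (k * \<delta>) * (25 * (A + 4) * (real k + 1)\<^sup>2 * E)"
    using S(2) BE B0 by (intro mult_mono) auto
  finally have "(\<Sum>x\<in>T. w x) * real m ^ 2 \<le> 2 powr (k * \<delta>) * (25 * (A + 4) * (real k + 1)\<^sup>2 * E)" .
  moreover have "(\<Sum>x\<in>T. w x) * (2 powr (k * \<sigma>)) ^ 2 \<le> (\<Sum>x\<in>T. w x) * real m ^ 2"
    using m w by (intro mult_left_mono power_mono sum_nonneg) auto
  ultimately have "(\<Sum>x\<in>T. w x) * (2 powr (k * \<sigma>)) ^ 2 \<le> 2 powr (k * \<delta>) * (25 * (A + 4) * (real k + 1)\<^sup>2 * E)"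
    by linarith
  then have "(\<Sum>x\<in>T. w x) \<le> 2 powr (k * \<delta>) * (25 * (A + 4) * (real k + 1)\<^sup>2 * E) / (2 powr (k * \<sigma>)) ^ 2"
    by (simp add: pos_le_divide_eq)
  also have "\<dots> = 25 * (A + 4) * (real k + 1)\<^sup>2 * (2 powr (k * \<delta>) * E / (2 powr (k * \<sigma>)) ^ 2)"
    by simp
  also have "2 powr (k * \<delta>) * E / (2 powr (k * \<sigma>)) ^ 2 = 2 powr (k * (\<delta> - \<sigma> - t * (\<sigma> - 1)))"
    unfolding E_def power2_eq_square by (simp add: algebra_simps flip: powr_add powr_diff)
  finally have W: "(\<Sum>x\<in>T. w x) \<le> 25 * (A + 4) * (real k + 1)\<^sup>2 * 2 powr (k * (\<delta> - \<sigma> - t * (\<sigma> - 1)))" .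
  have "2 powr t \<le> 2 powr 1" using t by (intro powr_mono) auto
  then have "2 powr t * (\<Sum>x\<in>T. w x) \<le> 2 * (25 * (A + 4) * (real k + 1)\<^sup>2 * 2 powr (k * (\<delta> - \<sigma> - t * (\<sigma> - 1))))"
    using W w by (intro mult_mono sum_nonneg) auto
  moreover have fifty: "2 * (25 * (A + 4) * p * q) = 50 * (A + 4) * p * q" for p q by simp
  ultimately have "ennreal (2 powr t * (\<Sum>x\<in>T. w x)) \<le> ennreal (50 * (A + 4) * (real k + 1)\<^sup>2 * 2 powr (k * (\<delta> - \<sigma> - t * (\<sigma> - 1))))"
    by (intro ennreal_leI) (simp only: fifty)
  with cont show ?thesis by (rule order_trans)
qed

section \<open>Covering by dyadic squares\<close>

lemma card_cells_le:
  assumes "\<And>u v. u \<in> X \<Longrightarrow> v \<in> X \<Longrightarrow> dist u v \<le> real m / 2 ^ k"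
  shows "finite (cell k ` X)" "card (cell k ` X) \<le> (2 * m + 1)\<^sup>2"
proof -
  have "finite (cell k ` X) \<and> card (cell k ` X) \<le> (2 * m + 1)\<^sup>2"
  proof (cases "X = {}")
    case False
    then obtain u where "u \<in> X" by blast
    then show ?thesis using card_near_cells[where u = u and A = X] assms by blast
  qed simp
  then show "finite (cell k ` X)" "card (cell k ` X) \<le> (2 * m + 1)\<^sup>2" by auto
qed

lemma content_inf_le_card_cells:
  assumes "0 < s" "finite Q" "X \<subseteq> {z. cell k z \<in> Q}"
  shows "content_inf s X \<le> ennreal (real (card Q) * (2 powr s * (2 powr (-s)) ^ k))"
proof -
  have "X \<subseteq> (\<Union>q\<in>Q. {z. cell k z = q})" using assms(3) by auto
  then have "content_inf s X \<le> content_inf s (\<Union>q\<in>Q. {z. cell k z = q})" by (rule content_inf_mono)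
  also have "\<dots> \<le> (\<Sum>q\<in>Q. content_inf s {z. cell k z = q})" by (rule content_inf_finite_UN[OF assms(1,2)])
  also have "\<dots> \<le> (\<Sum>q\<in>Q. ennreal (2 powr s * (2 powr (-s)) ^ k))"
    by (intro sum_mono content_inf_cell[OF assms(1)]) auto
  also have "\<dots> = ennreal (\<Sum>q\<in>Q. 2 powr s * (2 powr (-s)) ^ k)"
    by (rule sum_ennreal) simp
  finally show ?thesis by simp
qed

lemma content_inf_bounded_plane:
  fixes X :: "(real^2) set"
  assumes "bounded X" "2 < s"
  shows "content_inf s X = 0"
proof -
  obtain D where D: "\<And>u v. u \<in> X \<Longrightarrow> v \<in> X \<Longrightarrow> dist u v \<le> D"
    using assms(1) unfolding bounded_two_points by blast
  obtain N where N: "D \<le> real N" using real_arch_simple by blast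
  define r where "r = 4 * 2 powr (-s)"
  have r: "0 \<le> r" "r < 1"
  proof -
    have "2 powr (-s) < 2 powr (- real 2)" using assms(2) by (intro powr_less_mono) auto
    also have "\<dots> = 1 / 4" unfolding powr_minus powr_realpow[OF zero_less_two] by simp
    finally show "r < 1" by (simp add: r_def)
  qed (simp add: r_def)
  let ?c = "(2 * real N + 1)\<^sup>2 * 2 powr s"
  have bound: "content_inf s X \<le> ennreal (?c * r ^ k)" for k
  proof -
    have d: "dist u v \<le> real (N * 2 ^ k) / 2 ^ k" if "u \<in> X" "v \<in> X" for u v
      using D[OF that] N by simp
    have "content_inf s X \<le> ennreal (real (card (cell k ` X)) * (2 powr s * (2 powr (-s)) ^ k))"
      using assms(2) card_cells_le(1)[OF d] by (intro content_inf_le_card_cells) auto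
    also have "\<dots> \<le> ennreal (?c * r ^ k)"
    proof (rule ennreal_leI)
      have "real (card (cell k ` X)) \<le> real ((2 * (N * 2 ^ k) + 1)\<^sup>2)"
        using card_cells_le(2)[OF d] by (simp only: of_nat_le_iff)
      also have "\<dots> = (2 * real N * 2 ^ k + 1)\<^sup>2" by simp
      also have "\<dots> \<le> ((2 * real N + 1) * 2 ^ k)\<^sup>2"
        by (intro power_mono) (simp_all add: algebra_simps)
      also have "\<dots> = (2 * real N + 1)\<^sup>2 * 4 ^ k"
      proof -
        have "((2::real) ^ k)\<^sup>2 = (2\<^sup>2) ^ k" by (simp only: power_mult[symmetric] mult.commute)
        then show ?thesis by (simp add: power_mult_distrib)
      qed
      finally have "real (card (cell k ` X)) * (2 powr s * (2 powr (-s)) ^ k)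
          \<le> ((2 * real N + 1)\<^sup>2 * 4 ^ k) * (2 powr s * (2 powr (-s)) ^ k)"
        by (rule mult_right_mono) simp
      also have "\<dots> = ?c * r ^ k" by (simp add: r_def power_mult_distrib)
      finally show "real (card (cell k ` X)) * (2 powr s * (2 powr (-s)) ^ k) \<le> ?c * r ^ k" .
    qed
    finally show ?thesis .
  qed
  have "(\<lambda>k. ?c * r ^ k) \<longlonglongrightarrow> ?c * 0" using r by (intro tendsto_mult_left LIMSEQ_realpow_zero) auto
  then have "(\<lambda>k. ennreal (?c * r ^ k)) \<longlonglongrightarrow> ennreal 0" by (intro tendsto_ennrealI) simp
  then have "content_inf s X \<le> ennreal 0" by (rule LIMSEQ_le_const) (use bound in blast)
  then show ?thesis by simp
qed

text \<open>The covering sets are enlarged to have positive sizes \<open>a i\<close> with \<open>\<Sum>i. a i powr \<delta>\<close> still small,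
  and each is replaced by the at most nine squares that it meets at the dyadic scale of its size.
  Their total cost is at most one, so at most \<open>2 powr (k * \<delta>)\<close> squares of side \<open>1 / 2 ^ k\<close> are
  used; a total smaller than the cost of a square of side \<open>1 / 2 ^ K\<close> keeps all of them small.\<close>

lemma dyadic_cover:
  fixes \<Gamma> :: "(real^2) set" and \<delta> :: real and K :: nat
  assumes null: "content_inf \<delta> \<Gamma> = 0" and \<delta>: "0 < \<delta>"
  obtains S :: "nat \<Rightarrow> (int \<times> int) set"
  where "\<And>k. finite (S k)" "\<And>k. real (card (S k)) \<le> 2 powr (real k * \<delta>)"
    "\<And>k. k < K \<Longrightarrow> S k = {}" "\<Gamma> \<subseteq> (\<Union>k. {z. cell k z \<in> S k})"
proof -
  define \<eta> where "\<eta> = (1 / 2 ^ K) powr \<delta> / (50 * 2 powr \<delta>)"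
  have \<eta>: "0 < \<eta>" by (simp add: \<eta>_def)
  have "(1 / 2 ^ K) powr \<delta> \<le> (1::real) powr \<delta>" using \<delta> by (intro powr_mono2) auto
  then have K1: "(1 / 2 ^ K) powr \<delta> \<le> (1::real)" by simp
  then have \<eta>1: "50 * 2 powr \<delta> * \<eta> \<le> 1" by (simp add: \<eta>_def)
  have "2 powr 0 \<le> 2 powr \<delta>" using \<delta> by (intro powr_mono) auto
  then have "1 < 50 * 2 powr \<delta>" by simp
  then have \<eta>K: "\<eta> < (1 / 2 ^ K) powr \<delta>" unfolding \<eta>_def by (simp add: divide_less_eq)
  have "content_inf \<delta> \<Gamma> < ennreal (\<eta> / 2)" unfolding null using \<eta> by simp
  then obtain U where U: "\<Gamma> \<subseteq> (\<Union>i. U i)" "\<And>i. bounded (U i :: (real^2) set)"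
    "(\<Sum>i. ennreal (diameter (U i) powr \<delta>)) < ennreal (\<eta> / 2)"
    by (rule content_inf_less_cover) blast
  define b where "b i = diameter (U i) powr \<delta> + \<eta> / 2 * (1/2) ^ Suc i" for i
  have bpos: "0 < b i" for i using \<eta> by (simp add: b_def add_nonneg_pos)
  have bsum: "(\<Sum>i\<in>I. b i) \<le> \<eta>" if I: "finite I" for I
  proof -
    have "ennreal (\<Sum>i\<in>I. diameter (U i) powr \<delta>) = (\<Sum>i\<in>I. ennreal (diameter (U i) powr \<delta>))"
      by (rule sum_ennreal[symmetric]) simp
    also have "\<dots> \<le> (\<Sum>i. ennreal (diameter (U i) powr \<delta>))"
      by (rule sum_le_suminf) (use I in auto)
    finally have "ennreal (\<Sum>i\<in>I. diameter (U i) powr \<delta>) < ennreal (\<eta> / 2)" using U(3) by order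
    then have 1: "(\<Sum>i\<in>I. diameter (U i) powr \<delta>) < \<eta> / 2"
      by (rule ennreal_less_iff[THEN iffD1, rotated]) (simp add: sum_nonneg)
    have "(\<Sum>i\<in>I. (1/2) ^ Suc i) \<le> (\<Sum>i. (1/2::real) ^ Suc i)"
      by (rule sum_le_suminf[OF sums_summable[OF power_half_series] I]) simp
    then have "(\<Sum>i\<in>I. (1/2::real) ^ Suc i) \<le> 1" using sums_unique[OF power_half_series] by simp
    then have "\<eta> / 2 * (\<Sum>i\<in>I. (1/2) ^ Suc i) \<le> \<eta> / 2 * 1" using \<eta> by (intro mult_left_mono) auto
    moreover have "(\<Sum>i\<in>I. b i) = (\<Sum>i\<in>I. diameter (U i) powr \<delta>) + \<eta> / 2 * (\<Sum>i\<in>I. (1/2) ^ Suc i)"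
      unfolding b_def by (simp only: sum.distrib sum_distrib_left)
    ultimately show ?thesis using 1 by linarith
  qed
  \<comment> \<open>The summand \<open>\<eta> / 2 * (1/2) ^ Suc i\<close> of \<open>b i\<close> keeps \<open>a i\<close> positive for sets of diameter 0.\<close>
  define a where "a i = b i powr (1 / \<delta>)" for i
  have apos: "0 < a i" for i using bpos[of i] by (simp add: a_def)
  have ab: "a i powr \<delta> = b i" for i using bpos[of i] \<delta> by (simp add: a_def powr_powr)
  have diam: "diameter (U i) \<le> a i" for i
  proof -
    have "diameter (U i) powr \<delta> \<le> b i" using \<eta> by (simp add: b_def)
    then have "(diameter (U i) powr \<delta>) powr (1 / \<delta>) \<le> a i"
      unfolding a_def using \<delta> by (intro powr_mono2) auto
    then show ?thesis using \<delta> diameter_ge_0[OF U(2)[of i]] by (simp add: powr_powr)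
  qed
  have aK: "a i < 1 / 2 ^ K" for i
  proof (rule ccontr)
    assume "\<not> a i < 1 / 2 ^ K"
    then have "(1 / 2 ^ K) powr \<delta> \<le> a i powr \<delta>" using \<delta> by (intro powr_mono2) auto
    then show False using bsum[of "{i}"] \<eta>K ab[of i] by simp
  qed
  have "\<exists>k. K \<le> k \<and> 2 ^ k \<le> 1 / a i \<and> 1 / a i \<le> 2 ^ Suc k" for i
  proof -
    have gt: "2 ^ K < 1 / a i" using aK[of i] apos[of i] by (simp add: field_simps)
    moreover have "(1::real) \<le> 2 ^ K" by simp
    ultimately have "1 \<le> 1 / a i" by linarith
    moreover obtain n where "1 / a i < 2 ^ n" using real_arch_pow[of 2 "1 / a i"] by auto
    ultimately obtain k where k: "2 ^ k \<le> 1 / a i" "1 / a i \<le> 2 ^ Suc k"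
      using dyadic_bracket[of "1 / a i" n] by (metis less_imp_le)
    have "(2::real) ^ K < 2 ^ Suc k" using gt k(2) by linarith
    then have "K < Suc k" by (rule power_less_imp_less_exp[rotated]) simp
    then show ?thesis using k by (intro exI[of _ k]) auto
  qed
  then obtain \<kappa> where \<kappa>: "\<And>i. K \<le> \<kappa> i" "\<And>i. 2 ^ \<kappa> i \<le> 1 / a i" "\<And>i. 1 / a i \<le> 2 ^ Suc (\<kappa> i)"
    by metis
  have near: "dist u v \<le> real 1 / 2 ^ \<kappa> i" if "u \<in> U i" "v \<in> U i" for u v i
  proof -
    have "a i \<le> 1 / 2 ^ \<kappa> i" using \<kappa>(2)[of i] apos[of i] by (simp add: field_simps)
    then show ?thesis using diameter_bounded_bound[OF U(2) that] diam[of i] by simp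
  qed
  have bk: "(2 powr \<delta>) * b i * 2 powr (\<kappa> i * \<delta>) \<ge> 1" for i
  proof -
    have "1 \<le> a i * 2 ^ Suc (\<kappa> i)" using \<kappa>(3)[of i] apos[of i] by (simp add: field_simps)
    then have "1 powr \<delta> \<le> (a i * 2 ^ Suc (\<kappa> i)) powr \<delta>" using \<delta> by (intro powr_mono2) auto
    also have "\<dots> = b i * (2 ^ Suc (\<kappa> i)) powr \<delta>" using apos[of i] by (simp add: powr_mult ab)
    also have "(2 ^ Suc (\<kappa> i)) powr \<delta> = 2 powr (\<delta> + \<kappa> i * \<delta>)"
    proof -
      have "(2::real) ^ Suc (\<kappa> i) = 2 powr (1 + real (\<kappa> i))" by (simp add: powr_add powr_realpow)
      then show ?thesis by (simp only: powr_powr distrib_right mult_1_left)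
    qed
    finally show ?thesis by (simp add: powr_add mult_ac)
  qed
  define S where "S k = (\<Union>i\<in>{i. \<kappa> i = k}. cell k ` U i)" for k
  have fin: "finite (S k) \<and> card (S k) \<le> nat \<lfloor>2 powr (k * \<delta>)\<rfloor>" for k
  proof (rule finite_if_finite_subsets_card_bdd)
    show "card F \<le> nat \<lfloor>2 powr (k * \<delta>)\<rfloor>" if F: "F \<subseteq> S k" "finite F" for F
    proof -
      have "\<forall>c\<in>F. \<exists>i. \<kappa> i = k \<and> c \<in> cell k ` U i" using F(1) unfolding S_def by blast
      then obtain f where f: "\<And>c. c \<in> F \<Longrightarrow> \<kappa> (f c) = k \<and> c \<in> cell k ` U (f c)" by metis
      let ?I = "f ` F"
      have fI: "finite ?I" using F(2) by simp
      have c9: "finite (cell k ` U i) \<and> card (cell k ` U i) \<le> 9" if "i \<in> ?I" for i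
        using card_cells_le[of "U i" 1 k] near[of _ i] f that by force
      have "F \<subseteq> (\<Union>i\<in>?I. cell k ` U i)" using f by blast
      moreover have "finite (\<Union>i\<in>?I. cell k ` U i)" using fI c9 by blast
      ultimately have "card F \<le> card (\<Union>i\<in>?I. cell k ` U i)" by (intro card_mono)
      also have "\<dots> \<le> (\<Sum>i\<in>?I. card (cell k ` U i))" by (rule card_UN_le[OF fI])
      also have "\<dots> \<le> (\<Sum>i\<in>?I. 9)" using c9 by (intro sum_mono) blast
      finally have "real (card F) \<le> real (9 * card ?I)" by (simp only: of_nat_le_iff) simp
      also have "\<dots> = 9 * (\<Sum>i\<in>?I. 1)" by simp
      also have "\<dots> \<le> 9 * (\<Sum>i\<in>?I. (2 powr \<delta>) * b i * 2 powr (k * \<delta>))"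
        using bk f by (intro mult_left_mono sum_mono) auto
      also have "\<dots> = 9 * 2 powr \<delta> * 2 powr (k * \<delta>) * (\<Sum>i\<in>?I. b i)"
        by (simp add: sum_distrib_left sum_distrib_right mult_ac)
      also have "\<dots> \<le> 9 * 2 powr \<delta> * 2 powr (k * \<delta>) * \<eta>"
        using bsum[OF fI] by (intro mult_left_mono) auto
      also have "\<dots> \<le> 2 powr (k * \<delta>)"
      proof -
        have "9 * 2 powr \<delta> * \<eta> \<le> 50 * 2 powr \<delta> * \<eta>" using \<eta> by (intro mult_right_mono) auto
        then have "9 * 2 powr \<delta> * \<eta> \<le> 1" using \<eta>1 by linarith
        then have "(9 * 2 powr \<delta> * \<eta>) * 2 powr (k * \<delta>) \<le> 1 * 2 powr (k * \<delta>)" by (rule mult_right_mono) simp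
        then show ?thesis by (simp add: mult_ac)
      qed
      finally show ?thesis by (simp add: le_nat_floor)
    qed
  qed
  show thesis
  proof (rule that[of S])
    fix k
    show "finite (S k)" using fin by blast
    have "real (card (S k)) \<le> real (nat \<lfloor>2 powr (k * \<delta>)\<rfloor>)" using fin by (simp only: of_nat_le_iff)
    also have "\<dots> \<le> 2 powr (k * \<delta>)" by (simp add: of_nat_floor)
    finally show "real (card (S k)) \<le> 2 powr (k * \<delta>)" .
    show "S k = {}" if kK: "k < K"
    proof -
      have "\<kappa> i \<noteq> k" for i using kK \<kappa>(1)[of i] by linarith
      then show ?thesis by (simp add: S_def)
    qed
  next
    show "\<Gamma> \<subseteq> (\<Union>k. {z. cell k z \<in> S k})"
    proof
      fix z assume "z \<in> \<Gamma>"
      then obtain i where "z \<in> U i" using U(1) by blast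
      then have "cell (\<kappa> i) z \<in> S (\<kappa> i)" by (auto simp: S_def)
      then show "z \<in> (\<Union>k. {z. cell k z \<in> S k})" by blast
    qed
  qed
qed

section \<open>Viewpoints with a large visible part\<close>

lemma summable_square_exp:
  fixes g :: real
  assumes "0 < g"
  shows "summable (\<lambda>k::nat. (real k + 1)\<^sup>2 * 2 powr (- (k * g)))"
proof -
  define \<beta> where "\<beta> = g * ln 2 / 4"
  have \<beta>: "0 < \<beta>" using assms by (simp add: \<beta>_def)
  define r where "r = 2 powr (- g / 2)"
  have r: "0 < r" "r < 1"
  proof -
    have "2 powr (- g / 2) < 2 powr 0" using assms by (intro powr_less_mono) auto
    then show "r < 1" by (simp add: r_def)
  qed (simp add: r_def)
  \<comment> \<open>The linear factor is absorbed by a quarter of the exponential decay.\<close>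
  have le: "(real k + 1)\<^sup>2 * 2 powr (- (k * g)) \<le> (1 + 1 / \<beta>)\<^sup>2 * r ^ k" for k :: nat
  proof -
    have "1 + k * \<beta> \<le> exp (k * \<beta>)" by (rule exp_ge_add_one_self)
    also have "exp (k * \<beta>) = 2 powr (k * g / 4)" by (simp add: powr_def \<beta>_def)
    finally have e: "1 + k * \<beta> \<le> 2 powr (k * g / 4)" .
    have "real k + 1 \<le> (1 + 1 / \<beta>) * (1 + k * \<beta>)" using \<beta> by (simp add: field_simps)
    also have "\<dots> \<le> (1 + 1 / \<beta>) * 2 powr (k * g / 4)" using e \<beta> by (intro mult_left_mono) auto
    finally have "(real k + 1)\<^sup>2 \<le> ((1 + 1 / \<beta>) * 2 powr (k * g / 4))\<^sup>2" by (intro power_mono) auto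
    also have "\<dots> = (1 + 1 / \<beta>)\<^sup>2 * 2 powr (k * g / 2)"
      unfolding power_mult_distrib power2_eq_square[of "_ powr _"] powr_add[symmetric] by (simp add: mult.commute)
    finally have "(real k + 1)\<^sup>2 * 2 powr (- (k * g)) \<le> (1 + 1 / \<beta>)\<^sup>2 * 2 powr (k * g / 2) * 2 powr (- (k * g))"
      by (rule mult_right_mono) simp
    also have "\<dots> = (1 + 1 / \<beta>)\<^sup>2 * 2 powr (k * g / 2 + - (k * g))" by (simp only: powr_add mult.assoc)
    also have "k * g / 2 + - (k * g) = (- g / 2) * k" by simp
    also have "2 powr ((- g / 2) * k) = r ^ k" by (simp add: r_def powr_powr flip: powr_realpow)
    finally show ?thesis .
  qed
  have "summable (\<lambda>k. (1 + 1 / \<beta>)\<^sup>2 * r ^ k)" using r by (intro summable_mult summable_geometric) simp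
  then show ?thesis by (rule summable_comparison_test'[where N = 0]) (use le in simp)
qed

lemma suminf_ennreal_tail:
  fixes f :: "nat \<Rightarrow> real"
  assumes "summable f" "\<And>k. 0 \<le> f k"
  shows "(\<Sum>k. if k < K then 0 else ennreal (f k)) = ennreal (\<Sum>k. f (k + K))"
proof -
  let ?g = "\<lambda>k. if k < K then 0 else f k"
  have g: "summable ?g" by (rule summable_comparison_test'[OF assms(1), where N = 0]) (use assms(2) in auto)
  have "(\<lambda>k. if k < K then 0 else ennreal (f k)) = (\<lambda>k. ennreal (?g k))" by auto
  then have "(\<Sum>k. if k < K then 0 else ennreal (f k)) = (\<Sum>k. ennreal (?g k))" by (rule arg_cong)
  also have "\<dots> = ennreal (\<Sum>k. ?g k)" by (rule suminf_ennreal2) (use assms(2) g in auto)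
  also have "(\<Sum>k. ?g k) = (\<Sum>k. ?g (k + K)) + (\<Sum>k<K. ?g k)" by (rule suminf_split_initial_segment[OF g])
  also have "(\<Sum>k<K. ?g k) = 0" by (rule sum.neutral) auto
  finally show ?thesis by simp
qed

text \<open>The exponent \<open>\<sigma> < s\<close> pays for the pigeonhole over scales: a viewpoint that sees fewer than
  \<open>2 powr (k * \<sigma>)\<close> squares at every scale \<open>k \<ge> K\<close> sees a part of content at most the tail of a
  convergent series, which is less than \<open>c\<close> for large \<open>K\<close>.\<close>

lemma (in view) content_rich_piece_null:
  fixes \<Gamma> :: "(real^2) set"
  assumes conn: "connected \<Gamma>"
    and X0: "X \<subseteq> {z. cell 0 z = q0}"
    and seg: "\<And>x y. x \<in> X \<Longrightarrow> y \<in> X \<Longrightarrow> closed_segment x y \<inter> \<Gamma> = {}"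
    and null: "content_inf \<delta> \<Gamma> = 0" and \<delta>: "0 < \<delta>"
    and t: "0 < t" "t < 1" and \<sigma>: "1 < \<sigma>" "\<sigma> < s" "s \<le> 2"
    and gain: "\<delta> < \<sigma> + t * (\<sigma> - 1)"
    and c: "0 < c" and rich: "\<And>x. x \<in> X \<Longrightarrow> ennreal c \<le> content_inf s (visible_part \<Gamma> x \<inter> Z)"
  shows "content_inf t X = 0"
proof -
  obtain J where J: "M \<le> 2 ^ J"
    using real_arch_pow[of 2 M] by (auto intro: less_imp_le)
  define A where "A = 2450 * M * (4 * M + 2) + 792 * fibre_bound * (J + 1)"
  have A: "0 \<le> A" using M_nonneg by (simp add: A_def fibre_bound_def)
  define g where "g = \<sigma> + t * (\<sigma> - 1) - \<delta>"
  have g: "0 < g" using gain by (simp add: g_def)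
  define D where "D k = 50 * (A + 4) * ((real k + 1)\<^sup>2 * 2 powr (- (k * g)))" for k :: nat
  have D: "summable D" "\<And>k. 0 \<le> D k"
    unfolding D_def using A by (auto intro!: summable_mult summable_square_exp g)
  define R where "R k = 4 * ((real k + 1)\<^sup>2 * 2 powr (- (k * (s - \<sigma>))))" for k :: nat
  have R: "summable R" "\<And>k. 0 \<le> R k"
    unfolding R_def using \<sigma> by (auto intro!: summable_mult summable_square_exp)
  have "content_inf t X \<le> 0 + ennreal \<epsilon>" if \<epsilon>: "0 < \<epsilon>" for \<epsilon>
  proof -
    obtain N1 where N1: "\<And>n. N1 \<le> n \<Longrightarrow> norm (\<Sum>i. D (i + n)) < \<epsilon>"
      using suminf_exist_split[OF \<epsilon> D(1)] by blast
    obtain N2 where N2: "\<And>n. N2 \<le> n \<Longrightarrow> norm (\<Sum>i. R (i + n)) < c"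
      using suminf_exist_split[OF c R(1)] by blast
    define K where "K = max N1 N2"
    have K: "(\<Sum>i. D (i + K)) < \<epsilon>" "(\<Sum>i. R (i + K)) < c"
      using N1[of K] N2[of K] by (auto simp: K_def)
    obtain S where S: "\<And>k. finite (S k)" "\<And>k. real (card (S k)) \<le> 2 powr (real k * \<delta>)"
      "\<And>k. k < K \<Longrightarrow> S k = {}" "\<Gamma> \<subseteq> (\<Union>k. {z. cell k z \<in> S k})"
      using dyadic_cover[OF null \<delta>, of K] by blast
    define V where "V k x = {q \<in> S k. \<exists>u\<in>visible_part \<Gamma> x \<inter> Z. cell k u = q}" for k x
    define Y where "Y k = {x \<in> X. 2 powr (k * \<sigma>) \<le> real (card (V k x))}" for k
    have Y: "content_inf t (Y k) \<le> (if k < K then 0 else ennreal (D k))" for k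
    proof (cases "k < K")
      case True
      then have "V k x = {}" for x using S(3) by (auto simp: V_def)
      then have "Y k = {}" by (simp add: Y_def)
      then show ?thesis by (simp add: content_inf_empty t(1))
    next
      case False
      have "content_inf t (Y k) \<le> ennreal (50 * (A + 4) * (real k + 1)\<^sup>2 * 2 powr (k * (\<delta> - \<sigma> - t * (\<sigma> - 1))))"
      proof (rule content_of_rich_viewpoints[where V = "V k" and S = "S k" and ?q0.0 = q0, OF t \<sigma>(1) _ A S(1) S(2)])
        fix x y assume xy: "x \<in> Y k" "y \<in> Y k" "x \<noteq> y"
        show "real (card (V k x \<inter> V k y)) \<le> A * (real k + 1) * 2 ^ k / dist x y"
          unfolding A_def
          by (rule card_squares_seen_from_both[OF conn _ _ xy(3) seg _ _ _ J])
            (use xy S(1) in \<open>auto simp: Y_def V_def\<close>)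
      qed (use \<sigma> X0 in \<open>auto simp: Y_def V_def\<close>)
      moreover have "50 * (A + 4) * (real k + 1)\<^sup>2 * 2 powr (k * (\<delta> - \<sigma> - t * (\<sigma> - 1))) = D k"
      proof -
        have "k * (\<delta> - \<sigma> - t * (\<sigma> - 1)) = - (k * g)" by (simp add: g_def algebra_simps)
        then show ?thesis by (simp add: D_def)
      qed
      ultimately show ?thesis using False by simp
    qed
    have "X \<subseteq> (\<Union>k. Y k)"
    proof
      fix x assume x: "x \<in> X"
      show "x \<in> (\<Union>k. Y k)"
      proof (rule ccontr)
        assume no: "x \<notin> (\<Union>k. Y k)"
        let ?G = "visible_part \<Gamma> x \<inter> Z"
        have poor: "real (card (V k x)) < 2 powr (k * \<sigma>)" for k
          using no x by (auto simp: Y_def not_le)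
        let ?P = "\<lambda>k. {z \<in> ?G. cell k z \<in> V k x}"
        have "?G \<subseteq> (\<Union>k. ?P k)"
        proof
          fix z assume z: "z \<in> ?G"
          then have "z \<in> \<Gamma>" by (simp add: visible_part_def)
          then obtain k where "cell k z \<in> S k" using S(4) by blast
          then have "z \<in> ?P k" using z by (auto simp: V_def)
          then show "z \<in> (\<Union>k. ?P k)" by (rule UN_I[OF UNIV_I])
        qed
        then have "content_inf s ?G \<le> content_inf s (\<Union>k. ?P k)" by (rule content_inf_mono)
        also have "\<dots> \<le> (\<Sum>k. content_inf s (?P k))" using \<sigma> by (intro content_inf_UN) auto
        also have "\<dots> \<le> (\<Sum>k. if k < K then 0 else ennreal (R k))"
        proof (rule suminf_le)
          fix k
          have finV: "finite (V k x)" using S(1) by (auto simp: V_def)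
          have 1: "content_inf s (?P k) \<le> ennreal (real (card (V k x)) * (2 powr s * (2 powr (-s)) ^ k))"
            by (rule content_inf_le_card_cells[OF _ finV]) (use \<sigma> in auto)
          show "content_inf s (?P k) \<le> (if k < K then 0 else ennreal (R k))"
          proof (cases "k < K")
            case True
            then have "V k x = {}" using S(3) by (auto simp: V_def)
            then show ?thesis using 1 by simp
          next
            case False
            have p4: "2 powr s \<le> 2 powr 2" using \<sigma> by (intro powr_mono) auto
            have "real (card (V k x)) * (2 powr s * (2 powr (-s)) ^ k) \<le> 2 powr (k * \<sigma>) * (2 powr 2 * 2 powr (- s * k))"
            proof (intro mult_mono)
              show "(2 powr (-s)) ^ k \<le> 2 powr (- s * k)" by (simp add: powr_powr flip: powr_realpow)
            qed (use poor[of k] p4 in \<open>auto intro: less_imp_le\<close>)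
            also have "\<dots> = 4 * (1 * 2 powr (- (k * (s - \<sigma>))))" by (simp add: algebra_simps flip: powr_add)
            also have "\<dots> \<le> R k" unfolding R_def by (intro mult_left_mono mult_right_mono) auto
            finally show ?thesis using 1 False by (simp add: ennreal_leI order_trans)
          qed
        qed auto
        also have "\<dots> = ennreal (\<Sum>k. R (k + K))" by (rule suminf_ennreal_tail[OF R])
        also have "\<dots> < ennreal c" using K(2) c by (simp add: ennreal_lessI)
        finally show False using rich[OF x] by simp
      qed
    qed
    then have "content_inf t X \<le> content_inf t (\<Union>k. Y k)" by (rule content_inf_mono)
    also have "\<dots> \<le> (\<Sum>k. content_inf t (Y k))" by (rule content_inf_UN[OF t(1)])
    also have "\<dots> \<le> (\<Sum>k. if k < K then 0 else ennreal (D k))" by (rule suminf_le) (use Y in auto)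
    also have "\<dots> = ennreal (\<Sum>k. D (k + K))" by (rule suminf_ennreal_tail[OF D])
    also have "\<dots> \<le> ennreal \<epsilon>" using K(1) by (intro ennreal_leI) simp
    finally show ?thesis by simp
  qed
  then have "content_inf t X \<le> 0" by (rule ennreal_le_epsilon)
  then show ?thesis by simp
qed

text \<open>Localisation: \<open>X\<close> consists of viewpoints in one square that keep away from \<open>\<Gamma>\<close> by a multiple of its
  side, and only the part of \<open>\<Gamma>\<close> in one square of the same side is looked at. All directions from
  the first square to the second then make acute angles with the direction of a single pair of points, and
  segments between viewpoints miss \<open>\<Gamma>\<close>.\<close>

lemma viewpoint_piece_null:
  fixes \<Gamma> :: "(real^2) set" and L :: nat and q q' :: "int \<times> int"
  assumes conn: "connected \<Gamma>"
    and null: "content_inf \<delta> \<Gamma> = 0" and \<delta>: "0 < \<delta>"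
    and t: "0 < t" "t < 1" and \<sigma>: "1 < \<sigma>" "\<sigma> < s" "s \<le> 2"
    and gain: "\<delta> < \<sigma> + t * (\<sigma> - 1)" and c: "0 < c"
  defines "X \<equiv> {x. cell L x = q \<and> (\<forall>g\<in>\<Gamma>. 8 / 2 ^ L \<le> dist x g) \<and>
      ennreal c \<le> content_inf s (visible_part \<Gamma> x \<inter> {z. cell L z = q'})}"
  shows "content_inf t X = 0"
proof (cases "X = {}")
  case True
  then show ?thesis by (simp add: content_inf_empty t(1))
next
  case False
  then obtain x0 where x0: "x0 \<in> X" by blast
  define Z where "Z = {z \<in> \<Gamma>. cell L z = q'}"
  have Zeq: "visible_part \<Gamma> x \<inter> {z. cell L z = q'} = visible_part \<Gamma> x \<inter> Z" for x
    by (auto simp: Z_def visible_part_def)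
  have "Z \<noteq> {}"
  proof
    assume "Z = {}"
    then have "ennreal c \<le> content_inf s ({} :: (real^2) set)" using x0 Zeq[of x0] by (simp add: X_def)
    then show False using c \<sigma> by (simp add: content_inf_empty)
  qed
  then obtain z0 where z0: "z0 \<in> Z" by blast
  let ?r = "1 / 2 ^ L :: real"
  have r: "0 < ?r" by simp
  define D where "D = dist x0 z0"
  have D: "8 * ?r \<le> D" using x0 z0 by (auto simp: X_def Z_def D_def)
  have D0: "0 < D" using D r by linarith
  define e where "e = (z0 - x0) /\<^sub>R D"
  have e: "norm e = 1" using D0 by (simp add: e_def D_def dist_norm norm_minus_commute)
  have near: "norm (x - x0) \<le> 2 * ?r" "norm (z - z0) \<le> 2 * ?r" if "x \<in> X" "z \<in> Z" for x z
    using dist_same_cell[of L x x0] dist_same_cell[of L z z0] that x0 z0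
    by (auto simp: X_def Z_def dist_norm)
  have inner_le: "\<bar>e \<bullet> v\<bar> \<le> norm v" for v using Cauchy_Schwarz_ineq2[of e v] e by simp
  have ez: "e \<bullet> (z0 - x0) = D"
    using D0 by (simp add: e_def D_def dist_norm norm_minus_commute power2_norm_eq_inner[symmetric] power2_eq_square)
  have "view e X Z (4 * ?r) (D + 4 * ?r)"
  proof
    show "norm e = 1" by (rule e)
    show "0 < 4 * ?r" by simp
    show "0 \<le> D + 4 * ?r" using D0 r by linarith
    fix x z assume xz: "x \<in> X" "z \<in> Z"
    have eq: "z - x = (z0 - x0) + (z - z0) - (x - x0)" by simp
    have "e \<bullet> (z - x) = D + e \<bullet> (z - z0) - e \<bullet> (x - x0)"
      unfolding ez[symmetric] inner_diff_right[symmetric] inner_add_right[symmetric] by (simp add: algebra_simps)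
    then show "4 * ?r \<le> e \<bullet> (z - x)"
      using inner_le[of "z - z0"] inner_le[of "x - x0"] near[OF xz] D by linarith
    have "norm (z - x) \<le> norm ((z0 - x0) + (z - z0)) + norm (x - x0)"
      unfolding eq by (rule norm_triangle_ineq4)
    also have "\<dots> \<le> norm (z0 - x0) + norm (z - z0) + norm (x - x0)"
      by (intro add_right_mono norm_triangle_ineq)
    also have "norm (z0 - x0) = D" by (simp add: D_def dist_norm norm_minus_commute)
    finally show "norm (z - x) \<le> D + 4 * ?r" using near[OF xz] by linarith
  qed
  then interpret view e X Z "4 * ?r" "D + 4 * ?r" .
  show ?thesis
  proof (rule content_rich_piece_null[OF conn _ _ null \<delta> t \<sigma> gain c])
    show "X \<subseteq> {z. cell 0 z = cell 0 x0}"
      using x0 by (auto simp: X_def intro: cell_ancestor[of L])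
    fix x assume x: "x \<in> X"
    show "ennreal c \<le> content_inf s (visible_part \<Gamma> x \<inter> Z)"
      using x Zeq[of x] by (simp add: X_def)
    fix y assume y: "y \<in> X"
    show "closed_segment x y \<inter> \<Gamma> = {}"
    proof (rule ccontr)
      assume "closed_segment x y \<inter> \<Gamma> \<noteq> {}"
      then obtain g where g: "g \<in> closed_segment x y" "g \<in> \<Gamma>" by blast
      have "dist x g \<le> dist x y"
        using segment_bound(1)[OF g(1)] by (simp add: dist_norm norm_minus_commute)
      also have "\<dots> \<le> 2 / 2 ^ L" using x y by (intro dist_same_cell) (auto simp: X_def)
      also have "\<dots> < 8 / (2 ^ L :: real)" by (intro divide_strict_right_mono) auto
      finally have "dist x g < 8 / 2 ^ L" .
      then show False using x g by (force simp: X_def)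
    qed
  qed
qed

text \<open>A viewpoint with a large visible part is not in \<open>\<Gamma>\<close>, from where only the point itself
  is visible. Hence countably many of the localised pieces cover all such viewpoints.\<close>

lemma rich_viewpoints_null:
  fixes \<Gamma> :: "(real^2) set"
  assumes \<Gamma>: "compact \<Gamma>" "connected \<Gamma>"
    and null: "content_inf \<delta> \<Gamma> = 0" and \<delta>: "0 < \<delta>"
    and t: "0 < t" "t < 1" and \<sigma>: "1 < \<sigma>" "\<sigma> < s" "s \<le> 2"
    and gain: "\<delta> < \<sigma> + t * (\<sigma> - 1)"
  shows "content_inf t {x. hausdorff_dim (visible_part \<Gamma> x) > ereal s} = 0"
proof -
  let ?E = "{x. hausdorff_dim (visible_part \<Gamma> x) > ereal s}"
  have s0: "0 < s" using \<sigma> by simp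
  define P where "P = (\<lambda>(L, q, q', m). {x. cell L x = q \<and> (\<forall>g\<in>\<Gamma>. 8 / 2 ^ L \<le> dist x g) \<and>
      ennreal (1 / real (Suc m)) \<le> content_inf s (visible_part \<Gamma> x \<inter> {z. cell L z = q'})})"
  have "?E \<subseteq> (\<Union>i. P i)"
  proof
    fix x assume "x \<in> ?E"
    then have pos: "content_inf s (visible_part \<Gamma> x) \<noteq> 0"
      using hausdorff_dim_leI[OF s0] by (metis mem_Collect_eq not_le)
    have "x \<notin> \<Gamma>"
    proof
      assume "x \<in> \<Gamma>"
      then have "u = x" if "u \<in> visible_part \<Gamma> x" for u
      proof -
        have "x \<in> closed_segment x u \<inter> \<Gamma>" using \<open>x \<in> \<Gamma>\<close> by simp
        also have "closed_segment x u \<inter> \<Gamma> = {u}" using that by (simp add: visible_part_def)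
        finally show ?thesis by simp
      qed
      then have "visible_part \<Gamma> x \<subseteq> {x}" by blast
      then have "content_inf s (visible_part \<Gamma> x) \<le> content_inf s {x}" by (rule content_inf_mono)
      also have "\<dots> \<le> ennreal (diameter {x} powr s)" by (rule content_inf_bounded) (use s0 in auto)
      finally show False using pos by simp
    qed
    then obtain d where d: "0 < d" "\<And>g. g \<in> \<Gamma> \<Longrightarrow> d \<le> dist x g"
      using separate_point_closed[OF compact_imp_closed[OF \<Gamma>(1)]] by blast
    obtain L where "8 / d < 2 ^ L" using real_arch_pow[of 2 "8 / d"] by auto
    then have L: "8 / 2 ^ L \<le> d" using d(1) by (simp add: field_simps)
    have "\<exists>q'. content_inf s (visible_part \<Gamma> x \<inter> {z. cell L z = q'}) \<noteq> 0"
    proof (rule ccontr)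
      assume "\<not> ?thesis"
      then have "content_inf s (\<Union>q'\<in>UNIV. visible_part \<Gamma> x \<inter> {z. cell L z = q'}) = 0"
        by (intro content_inf_null_UN[OF s0]) auto
      moreover have "(\<Union>q'\<in>UNIV. visible_part \<Gamma> x \<inter> {z. cell L z = q'}) = visible_part \<Gamma> x" by auto
      ultimately show False using pos by simp
    qed
    then obtain q' where q': "content_inf s (visible_part \<Gamma> x \<inter> {z. cell L z = q'}) \<noteq> 0" by blast
    have "\<exists>m. ennreal (1 / real (Suc m)) \<le> content_inf s (visible_part \<Gamma> x \<inter> {z. cell L z = q'})"
    proof (cases "content_inf s (visible_part \<Gamma> x \<inter> {z. cell L z = q'})")
      case (real v)
      then have "0 < v" using q' by (metis ennreal_0 order_le_less)
      then obtain m where "1 / real (Suc m) < v" using nat_approx_posE by blast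
      then show ?thesis using real by (intro exI[of _ m]) (simp add: ennreal_leI)
    qed simp
    then obtain m where "ennreal (1 / real (Suc m)) \<le> content_inf s (visible_part \<Gamma> x \<inter> {z. cell L z = q'})"
      by blast
    then have "x \<in> P (L, cell L x, q', m)"
      unfolding P_def prod.case using d(2) L by (blast intro: order_trans)
    then show "x \<in> (\<Union>i. P i)" by (rule UN_I[OF UNIV_I])
  qed
  then have "content_inf t ?E \<le> content_inf t (\<Union>i. P i)" by (rule content_inf_mono)
  also have "content_inf t (\<Union>i. P i) = 0"
  proof (rule content_inf_null_UN[OF t(1)])
    fix i :: "nat \<times> (int \<times> int) \<times> (int \<times> int) \<times> nat"
    obtain L q q' m where "i = (L, q, q', m)" by (metis prod_cases4)
    then show "content_inf t (P i) = 0"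
      unfolding P_def
      using viewpoint_piece_null[OF \<Gamma>(2) null \<delta> t \<sigma> gain, of "1 / real (Suc m)" L q q'] by simp
  qed
  finally show ?thesis by simp
qed

lemma hausdorff_dim_plane_le_2:
  fixes X :: "(real^2) set"
  assumes "bounded X"
  shows "hausdorff_dim X \<le> 2"
proof (rule ccontr)
  assume "\<not> ?thesis"
  then have "ereal 2 < hausdorff_dim X" by simp
  then obtain d where d: "ereal 2 < ereal d" "ereal d < hausdorff_dim X"
    using ereal_dense2 by blast
  then have "2 < d" by simp
  then have "hausdorff_dim X \<le> ereal d"
    using content_inf_bounded_plane[OF assms] by (intro hausdorff_dim_leI) auto
  then show False using d by simp
qed

theorem theorem1p2:
  fixes \<Gamma> :: "(real ^ 2) set" and s :: real
  assumes "compact \<Gamma>" and "connected \<Gamma>"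
    and "hausdorff_dim \<Gamma> > 1"
    and "1 / 2 + sqrt (real_of_ereal (hausdorff_dim \<Gamma>) - 3 / 4) < s"
    and "ereal s \<le> hausdorff_dim \<Gamma>"
  shows "hausdorff_dim {x. hausdorff_dim (visible_part \<Gamma> x) > ereal s}
           \<le> (hausdorff_dim \<Gamma> - ereal s) / (ereal s - 1)"
proof -
  have le2: "hausdorff_dim \<Gamma> \<le> 2"
    by (rule hausdorff_dim_plane_le_2) (rule compact_imp_bounded[OF assms(1)])
  then obtain d where d: "hausdorff_dim \<Gamma> = ereal d"
    using assms(3) by (cases "hausdorff_dim \<Gamma>") auto
  have d12: "1 < d" "d \<le> 2" using le2 assms(3) unfolding d by auto
  have sd: "s \<le> d" using assms(5) d by simp
  have sq: "sqrt (d - 3 / 4) < s - 1 / 2" using assms(4) d by simp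
  have "sqrt (1 / 4) < sqrt (d - 3 / 4)" using d12 by simp
  then have s1: "1 < s" using sq by (simp add: real_sqrt_divide)
  have "(sqrt (d - 3 / 4))\<^sup>2 < (s - 1 / 2)\<^sup>2" using sq d12 by (intro power_strict_mono) auto
  then have "d - 3 / 4 < (s - 1 / 2)\<^sup>2" using d12 by simp
  then have ds: "d - s < (s - 1) * (s - 1)" by (simp add: power2_eq_square algebra_simps)
  define t0 where "t0 = (d - s) / (s - 1)"
  have t0: "0 \<le> t0" "t0 < 1"
  proof -
    show "0 \<le> t0" using sd s1 by (simp add: t0_def)
    have "t0 < s - 1" using ds s1 by (simp add: t0_def divide_less_eq)
    then show "t0 < 1" using sd d12 by linarith
  qed
  have rhs: "(hausdorff_dim \<Gamma> - ereal s) / (ereal s - 1) = ereal t0"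
    using s1 by (simp add: d t0_def one_ereal_def)
  show ?thesis unfolding rhs
  proof (rule dense_ge_bounded[of "ereal t0" 1])
    show "ereal t0 < 1" using t0 by (simp add: one_ereal_def)
    fix \<tau> :: ereal assume \<tau>: "ereal t0 < \<tau>" "\<tau> < 1"
    then obtain t where t: "\<tau> = ereal t" by (cases \<tau>) auto
    have tt: "t0 < t" "t < 1" using \<tau> by (auto simp: t one_ereal_def)
    define g where "g = t * (s - 1) - (d - s)"
    have g: "0 < g" using tt(1) s1 by (simp add: g_def t0_def divide_less_eq)
    \<comment> \<open>Room for replacing \<open>d\<close> by \<open>d + \<eta>\<close> and \<open>s\<close> by \<open>s - \<eta>\<close>.\<close>
    define \<eta> where "\<eta> = min (g / 4) ((s - 1) / 2)"
    have \<eta>: "0 < \<eta>" "4 * \<eta> \<le> g" "2 * \<eta> \<le> s - 1" using g s1 by (auto simp: \<eta>_def min_def)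
    have t\<eta>: "t * \<eta> \<le> \<eta>" using tt \<eta> by (intro mult_left_le_one_le) (use t0 in auto)
    have null: "content_inf (d + \<eta>) \<Gamma> = 0"
      by (rule content_inf_eq_0_of_dim_less) (use d d12 \<eta> in auto)
    have "content_inf t {x. hausdorff_dim (visible_part \<Gamma> x) > ereal s} = 0"
    proof (rule rich_viewpoints_null[OF assms(1,2) null, where \<sigma> = "s - \<eta>"])
      show "d + \<eta> < s - \<eta> + t * (s - \<eta> - 1)"
      proof -
        have "t * (s - \<eta> - 1) = t * (s - 1) - t * \<eta>" by (simp add: algebra_simps)
        then show ?thesis using \<eta> t\<eta> g_def by linarith
      qed
    qed (use d12 \<eta> tt t0 s1 sd in auto)
    then show "hausdorff_dim {x. hausdorff_dim (visible_part \<Gamma> x) > ereal s} \<le> \<tau>"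
      unfolding t using tt t0 by (intro hausdorff_dim_leI) auto
  qed
qed

end
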